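(* Let $N\ge2$, let $m_0$ be a non-singular wavelet filter of order $N$, and let $h\in L^1(\mathbb{T})$, $h\ge0$, satisfy $R_{m_0}(h)=h$. Let $\nu=\nu(m_0,h)$ be the corresponding measure on $K_N=\widehat{\mathbb{Z}[\frac1N]}$. Then $L^2(h)=L^2(\mathbb{T},h\,d\mu)$ embeds isometrically in $L^2(K_N,\nu)$, and the unitary operator $\pi_\nu(U)$ is an extension (or power dilation) to $L^2(K_N,\nu)$ of the isometry $S_0$ in $L^2(h)$, where $(S_0\xi)(z)=m_0(z)\xi(z^N)$.
   Context: $\mathbb{T}$ is the unit circle with normalized Haar measure $\mu$, $e_n(z)=z^n$. A wavelet filter of order $N$ is a function $m_0\in L^\infty(\mathbb{T})$ such that $\sum_{k=0}^{N-1}|m_0(e^{i2\pi k/N}z)|^2=N$ for a.a. $z$, $m_0$ is continuous near $z=1$, and $m_0(1)=\sqrt N$; non-singular means not vanishing on a set of positive measure. $R=R_{m_0}$ is $(Rf)(z)=\frac1N\sum_{w^N=z}|m_0(w)|^2f(w)$. $K_N$ is the compact Pontryagin dual of the discrete group $\mathbb{Z}[\frac1N]$. For a function $f$ on $\mathbb{T}$ and $i\ge0$, write $U^{-i}fU^i$ for the function $\chi\mapsto f(\chi(N^{-i}))$ on $K_N$ (so functions on $\mathbb{T}$ are viewed as functions on $K_N$ via $z=\chi(1)$; this gives the embedding of $L^2(h)$). The measure $\nu(m_0,h)$ is the unique finite positive Borel measure on $K_N$ with $\int_{K_N}U^{-i}fU^i\,d\nu=\int_{\mathbb{T}}R^i(fh)\,d\mu$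 for all $f\in C(\mathbb{T})$, $i=0,1,2,\dots$. The operator $\pi_\nu(U)$ on $L^2(K_N,\nu)$ is determined by $\pi_\nu(U)(U^{-(i+1)}fU^{i+1})=(U^{-i}fU^i)\,m_0$ for $f\in L^\infty(\mathbb{T})$, $i\ge 0$. *)

theory Defs
  imports "HOL-Analysis.Analysis"
begin

section \<open>\<open>L\<^sup>2\<close> and \<open>L\<^sup>\<infinity>\<close>\<close>

text \<open>
  Elements of \<open>L\<^sup>2(M)\<close> are given by representatives; two representatives denote the same
  element iff they agree \<open>M\<close>-almost everywhere.  Accordingly an operator between \<open>L\<^sup>2\<close> spaces
  is a map on representatives that respects almost-everywhere equality, and all identities
  between elements of \<open>L\<^sup>2\<close> are identities almost everywhere.
\<close>

definition L2 :: "'a measure \<Rightarrow> ('a \<Rightarrow> complex) set" where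
  "L2 M = {f \<in> borel_measurable M. integrable M (\<lambda>x. (cmod (f x))\<^sup>2)}"

definition L2_inner :: "'a measure \<Rightarrow> ('a \<Rightarrow> complex) \<Rightarrow> ('a \<Rightarrow> complex) \<Rightarrow> complex" where
  "L2_inner M f g = (\<integral>x. cnj (f x) * g x \<partial>M)"

definition L2_norm :: "'a measure \<Rightarrow> ('a \<Rightarrow> complex) \<Rightarrow> real" where
  "L2_norm M f = sqrt (\<integral>x. (cmod (f x))\<^sup>2 \<partial>M)"

definition Linf :: "'a measure \<Rightarrow> ('a \<Rightarrow> complex) set" where
  "Linf M = {f \<in> borel_measurable M. \<exists>C. AE x in M. cmod (f x) \<le> C}"

definition L2_linear ::
  "'a measure \<Rightarrow> 'b measure \<Rightarrow> (('a \<Rightarrow> complex) \<Rightarrow> ('b \<Rightarrow> complex)) \<Rightarrow> bool" where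
  "L2_linear M M' T \<longleftrightarrow>
     (\<forall>f\<in>L2 M. T f \<in> L2 M') \<and>
     (\<forall>f\<in>L2 M. \<forall>g\<in>L2 M. (AE x in M. f x = g x) \<longrightarrow> (AE y in M'. T f y = T g y)) \<and>
     (\<forall>f\<in>L2 M. \<forall>g\<in>L2 M. \<forall>a b.
        AE y in M'. T (\<lambda>x. a * f x + b * g x) y = a * T f y + b * T g y)"

definition L2_bounded_operator ::
  "'a measure \<Rightarrow> 'b measure \<Rightarrow> (('a \<Rightarrow> complex) \<Rightarrow> ('b \<Rightarrow> complex)) \<Rightarrow> bool" where
  "L2_bounded_operator M M' T \<longleftrightarrow>
     L2_linear M M' T \<and> (\<exists>C. \<forall>f\<in>L2 M. L2_norm M' (T f) \<le> C * L2_norm M f)"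

definition L2_isometry ::
  "'a measure \<Rightarrow> 'b measure \<Rightarrow> (('a \<Rightarrow> complex) \<Rightarrow> ('b \<Rightarrow> complex)) \<Rightarrow> bool" where
  "L2_isometry M M' T \<longleftrightarrow>
     L2_linear M M' T \<and> (\<forall>f\<in>L2 M. L2_norm M' (T f) = L2_norm M f)"

definition L2_unitary :: "'a measure \<Rightarrow> (('a \<Rightarrow> complex) \<Rightarrow> ('a \<Rightarrow> complex)) \<Rightarrow> bool" where
  "L2_unitary M T \<longleftrightarrow>
     L2_isometry M M T \<and> (\<forall>g\<in>L2 M. \<exists>f\<in>L2 M. AE x in M. T f x = g x)"

text \<open>
  With \<open>L\<^sup>2(M)\<close> identified with a subspace of \<open>L\<^sup>2(M')\<close> through the isometry \<open>J\<close>: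
  \<open>T\<close> extends \<open>S\<close> iff \<open>T J = J S\<close>, and \<open>T\<close> is a power dilation of \<open>S\<close> iff
  \<open>S\<^sup>n = J\<^sup>* T\<^sup>n J\<close> for all \<open>n\<close>.
\<close>

definition L2_extension ::
  "'a measure \<Rightarrow> 'b measure \<Rightarrow> (('a \<Rightarrow> complex) \<Rightarrow> ('b \<Rightarrow> complex)) \<Rightarrow>
   (('a \<Rightarrow> complex) \<Rightarrow> ('a \<Rightarrow> complex)) \<Rightarrow> (('b \<Rightarrow> complex) \<Rightarrow> ('b \<Rightarrow> complex)) \<Rightarrow> bool" where
  "L2_extension M M' J S T \<longleftrightarrow> (\<forall>\<xi>\<in>L2 M. AE y in M'. T (J \<xi>) y = J (S \<xi>) y)"

definition L2_power_dilation ::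
  "'a measure \<Rightarrow> 'b measure \<Rightarrow> (('a \<Rightarrow> complex) \<Rightarrow> ('b \<Rightarrow> complex)) \<Rightarrow>
   (('a \<Rightarrow> complex) \<Rightarrow> ('a \<Rightarrow> complex)) \<Rightarrow> (('b \<Rightarrow> complex) \<Rightarrow> ('b \<Rightarrow> complex)) \<Rightarrow> bool" where
  "L2_power_dilation M M' J S T \<longleftrightarrow>
     (\<forall>n. \<forall>\<xi>\<in>L2 M. \<forall>\<eta>\<in>L2 M.
        L2_inner M' (J \<eta>) ((T ^^ n) (J \<xi>)) = L2_inner M \<eta> ((S ^^ n) \<xi>))"


section \<open>The circle, wavelet filters and the transfer operator\<close>

definition haar_circle :: "complex measure" where
  "haar_circle =
     distr (restrict_space lborel {0..<1::real}) (restrict_space borel (sphere 0 1))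
       (\<lambda>t. cis (2 * pi * t))"

text \<open>
  Continuity near \<open>1\<close> and the value at \<open>1\<close> refer to the chosen representative of the
  \<open>L\<^sup>\<infinity>\<close> class.
\<close>

definition wavelet_filter :: "nat \<Rightarrow> (complex \<Rightarrow> complex) \<Rightarrow> bool" where
  "wavelet_filter N m0 \<longleftrightarrow>
     m0 \<in> Linf haar_circle \<and>
     (AE z in haar_circle.
        (\<Sum>k<N. (cmod (m0 (cis (2 * pi * real k / real N) * z)))\<^sup>2) = real N) \<and>
     (\<exists>V. open V \<and> 1 \<in> V \<and> continuous_on (V \<inter> sphere 0 1) m0) \<and>
     m0 1 = of_real (sqrt (real N))"

definition nonsingular :: "(complex \<Rightarrow> complex) \<Rightarrow> bool" where
  "nonsingular m0 \<longleftrightarrow> (AE z in haar_circle. m0 z \<noteq> 0)"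

definition transfer_op ::
  "nat \<Rightarrow> (complex \<Rightarrow> complex) \<Rightarrow> (complex \<Rightarrow> complex) \<Rightarrow> complex \<Rightarrow> complex" where
  "transfer_op N m0 f z =
     1 / of_nat N * (\<Sum>w\<in>{w. w ^ N = z}. of_real ((cmod (m0 w))\<^sup>2) * f w)"

definition weighted_circle :: "(complex \<Rightarrow> real) \<Rightarrow> complex measure" where
  "weighted_circle h = density haar_circle (\<lambda>z. ennreal (h z))"

definition S0 ::
  "nat \<Rightarrow> (complex \<Rightarrow> complex) \<Rightarrow> (complex \<Rightarrow> complex) \<Rightarrow> complex \<Rightarrow> complex" where
  "S0 N m0 \<xi> z = m0 z * \<xi> (z ^ N)"


section \<open>The solenoid\<close>

definition Z_inv :: "nat \<Rightarrow> rat set" where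
  "Z_inv N = {of_int k / of_nat N ^ i | k i. True}"

definition solenoid :: "nat \<Rightarrow> (rat \<Rightarrow> complex) set" where
  "solenoid N =
     {\<psi> \<in> Z_inv N \<rightarrow>\<^sub>E sphere 0 1. \<forall>x\<in>Z_inv N. \<forall>y\<in>Z_inv N. \<psi> (x + y) = \<psi> x * \<psi> y}"

text \<open>
  Since the group is discrete, the compact-open topology on its dual is the topology of
  pointwise convergence.
\<close>

definition solenoid_top :: "nat \<Rightarrow> (rat \<Rightarrow> complex) topology" where
  "solenoid_top N =
     subtopology (product_topology (\<lambda>_. top_of_set (sphere 0 1)) (Z_inv N)) (solenoid N)"

definition solenoid_borel :: "nat \<Rightarrow> (rat \<Rightarrow> complex) measure" where
  "solenoid_borel N = sigma (solenoid N) {V. openin (solenoid_top N) V}"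

text \<open>The function \<open>U\<^sup>-\<^sup>i f U\<^sup>i\<close> on the solenoid.\<close>

definition lift :: "nat \<Rightarrow> nat \<Rightarrow> (complex \<Rightarrow> complex) \<Rightarrow> (rat \<Rightarrow> complex) \<Rightarrow> complex" where
  "lift N i f \<psi> = f (\<psi> (1 / of_nat N ^ i))"

text \<open>\<open>\<nu>\<close> is the measure \<open>\<nu>(m\<^sub>0, h)\<close>, given by its characterizing property.\<close>

definition solenoid_measure ::
  "nat \<Rightarrow> (complex \<Rightarrow> complex) \<Rightarrow> (complex \<Rightarrow> real) \<Rightarrow> (rat \<Rightarrow> complex) measure \<Rightarrow> bool" where
  "solenoid_measure N m0 h \<nu> \<longleftrightarrow>
     finite_measure \<nu> \<and> sets \<nu> = sets (solenoid_borel N) \<and>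
     (\<forall>f i. continuous_on (sphere 0 1) f \<longrightarrow>
        (\<integral>\<psi>. lift N i f \<psi> \<partial>\<nu>) =
        (\<integral>z. (transfer_op N m0 ^^ i) (\<lambda>w. f w * of_real (h w)) z \<partial>haar_circle))"

text \<open>
  \<open>T\<close> is the operator \<open>\<pi>\<^sub>\<nu>(U)\<close>, given by its characterizing property; a function \<open>f\<close> on the
  circle is the function \<open>lift N 0 f\<close> on the solenoid.
\<close>

definition pi_U ::
  "nat \<Rightarrow> (complex \<Rightarrow> complex) \<Rightarrow> (rat \<Rightarrow> complex) measure \<Rightarrow>
   (((rat \<Rightarrow> complex) \<Rightarrow> complex) \<Rightarrow> ((rat \<Rightarrow> complex) \<Rightarrow> complex)) \<Rightarrow> bool" where
  "pi_U N m0 \<nu> T \<longleftrightarrow>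
     L2_bounded_operator \<nu> \<nu> T \<and>
     (\<forall>f\<in>Linf haar_circle. \<forall>i.
        AE \<psi> in \<nu>. T (lift N (Suc i) f) \<psi> = lift N i f \<psi> * lift N 0 m0 \<psi>)"

end

theory Submission
  imports Defs "HOL-Complex_Analysis.Cauchy_Integral_Theorem"
begin

text \<open>
  Two explicit objects carry the proof. On the circle, the averaging operator
  \<open>F \<mapsto> (z \<mapsto> 1/N \<Sum>\<^bsub>w^N = z\<^esub> F w)\<close> preserves the Haar integral, so the iterates of the transfer
  operator are absorbed into a density: \<open>\<integral> R\<^sup>i F d\<mu> = \<integral> W\<^sub>i F d\<mu>\<close> with
  \<open>W\<^sub>i z = \<Prod>\<^bsub>j<i\<^esub> |m\<^sub>0 (z^(N^j))|\<^sup>2\<close> (\<open>transfer_op_iterates\<close>). The property that characterizes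
  \<open>\<nu>\<close> therefore says that the image of \<open>\<nu>\<close> under the coordinate \<open>\<psi> \<mapsto> \<psi> (N^(-i))\<close> is
  \<open>W\<^sub>i h d\<mu>\<close> (\<open>distr_coord\<close>). For \<open>i = 0\<close> this image is \<open>h d\<mu>\<close>, which is the isometric embedding
  of \<open>L\<^sup>2(h)\<close>.

  On the solenoid, multiplication by \<open>N\<close> is an automorphism of \<open>\<int>[1/N]\<close> and hence induces an
  invertible shift \<open>\<sigma>\<close>, which lowers the level of a coordinate by one. Every lift is a function of
  one coordinate, so the only candidate for \<open>\<pi>\<^sub>\<nu>(U)\<close> is the weighted composition operator
  \<open>F \<mapsto> m\<^sub>0(\<psi> 1) F(\<sigma> \<psi>)\<close>. It is isometric because \<open>\<sigma>\<close> carries \<open>|m\<^sub>0(\<psi> 1)|\<^sup>2 d\<nu>\<close> to \<open>\<nu>\<close>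
  (\<open>distr_shift\<close>). On cylinder sets this is the recursion
  \<open>W\<^bsub>i+1\<^esub> z = W\<^sub>i z |m\<^sub>0 (z^(N^i))|\<^sup>2\<close>, and cylinder sets determine a finite measure because they
  are closed under intersection and generate the Borel sets (\<open>sets_solenoid_borel\<close>). It is
  surjective because \<open>\<sigma>\<close> is invertible and \<open>m\<^sub>0(\<psi> 1)\<close> vanishes only on a \<open>\<nu>\<close>-null set.

  A bounded operator with the property that characterizes \<open>\<pi>\<^sub>\<nu>(U)\<close> agrees with the candidate on
  indicators of cylinder sets, and then on all of \<open>L\<^sup>2(\<nu>)\<close> by linearity and dominated convergence
  (\<open>pi_U_unique\<close>), so it is unitary. On functions of the coordinate \<open>\<psi> 1\<close> the candidate acts as
  \<open>S\<^sub>0\<close>, since \<open>(\<sigma> \<psi>) 1 = (\<psi> 1)^N\<close>. This gives the extension property; isometry of \<open>S\<^sub>0\<close> is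
  inherited from the dilation, and the power dilation property follows by iteration.
\<close>


section \<open>Averaging over roots on the circle\<close>

lemma space_haar_circle [simp]: "space haar_circle = sphere 0 1"
  by (simp add: haar_circle_def space_restrict_space)

lemma sets_haar_circle [measurable_cong]:
  "sets haar_circle = sets (restrict_space borel (sphere 0 1))"
  by (simp add: haar_circle_def)

lemma sphere_in_sets_haar_circle [simp, measurable]: "sphere 0 1 \<in> sets haar_circle"
  using sets.top[of haar_circle] by simp

lemma circle_parametrization_measurable [measurable]:
  "(\<lambda>t. cis (2 * pi * t)) \<in> restrict_space lborel {0..<1::real} \<rightarrow>\<^sub>M restrict_space borel (sphere 0 1)"
proof (rule measurable_restrict_space2)
  have "continuous_on UNIV (\<lambda>t. cis (2 * pi * t))" by (intro continuous_intros)
  then have "(\<lambda>t. cis (2 * pi * t)) \<in> borel_measurable borel" by (rule borel_measurable_continuous_onI)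
  then show "(\<lambda>t. cis (2 * pi * t)) \<in> restrict_space lborel {0..<1::real} \<rightarrow>\<^sub>M borel"
    by (intro measurable_restrict_space1) simp
qed auto

lemma finite_measure_haar_circle: "finite_measure haar_circle"
  unfolding haar_circle_def
  by (rule finite_measure.finite_measure_distr)
    (auto intro!: finite_measureI simp: emeasure_restrict_space space_restrict_space)

definition root_average :: "nat \<Rightarrow> (complex \<Rightarrow> complex) \<Rightarrow> complex \<Rightarrow> complex" where
  "root_average N F z = 1 / of_nat N * (\<Sum>w | w ^ N = z. F w)"

lemma sum_roots_of_power:
  fixes F :: "complex \<Rightarrow> complex"
  assumes "N > 0" "c \<noteq> 0"
  shows "(\<Sum>w | w ^ N = c ^ N. F w) = (\<Sum>k<N. F (c * cis (2 * pi * real k / real N)))"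
proof -
  have bij: "bij_betw (\<lambda>z. c * z) {z. z ^ N = 1} {z. z ^ N = c ^ N}"
    by (rule bij_betw_byWitness[where f' = "\<lambda>z. z / c"])
      (use assms in \<open>auto simp: field_simps power_mult_distrib\<close>)
  have "bij_betw ((\<lambda>z. c * z) \<circ> (\<lambda>k. cis (2 * pi * real k / real N))) {..<N} {z. z ^ N = c ^ N}"
    using bij_betw_trans[OF Complex.bij_betw_roots_unity[OF assms(1)] bij] .
  from sum.reindex_bij_betw[OF this, of F] show ?thesis by simp
qed

text \<open>
  The \<open>N\<close> roots of \<open>z\<close> are the rotates of the single root \<open>exp (Ln z / N)\<close>, which depends
  measurably on \<open>z\<close>; this turns the average into a finite sum of measurable functions.
\<close>

lemma root_average_measurable:
  assumes N: "N > 0" and F: "F \<in> borel_measurable haar_circle"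
  shows "root_average N F \<in> borel_measurable haar_circle"
proof -
  define r where "r z = exp (Ln z / of_nat N)" for z :: complex
  have r: "r z ^ N = z" "r z \<noteq> 0" "cmod (r z) = 1" if "z \<in> sphere 0 1" for z
  proof -
    have "z \<noteq> 0" using that by auto
    then show *: "r z ^ N = z" using N by (simp add: r_def exp_of_nat_mult[symmetric])
    show "r z \<noteq> 0" by (simp add: r_def)
    have "cmod (r z) ^ N = 1" using that * by (metis dist_0_norm mem_sphere norm_power)
    then show "cmod (r z) = 1" using N by (metis norm_ge_zero power_eq_1_iff not_gr_zero real_root_pos2 real_root_one)
  qed
  have [measurable]: "r \<in> borel_measurable borel" unfolding r_def by measurable
  have "(\<lambda>z. F (r z * cis (2 * pi * real k / real N))) \<in> borel_measurable haar_circle" for k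
  proof (rule measurable_compose[OF _ F])
    have "(\<lambda>z. r z * cis (2 * pi * real k / real N)) \<in> haar_circle \<rightarrow>\<^sub>M restrict_space borel (sphere 0 1)"
    proof (rule measurable_restrict_space2)
      show "(\<lambda>z. r z * cis (2 * pi * real k / real N)) \<in> borel_measurable haar_circle"
        unfolding measurable_cong_sets[OF sets_haar_circle refl]
        by (intro measurable_restrict_space1) measurable
    qed (use r in \<open>auto simp: norm_mult\<close>)
    then show "(\<lambda>z. r z * cis (2 * pi * real k / real N)) \<in> haar_circle \<rightarrow>\<^sub>M haar_circle"
      by (simp add: measurable_cong_sets[OF refl sets_haar_circle])
  qed
  then have "(\<lambda>z. 1 / of_nat N * (\<Sum>k<N. F (r z * cis (2 * pi * real k / real N)))) \<in> borel_measurable haar_circle"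
    by measurable
  moreover have "root_average N F z = 1 / of_nat N * (\<Sum>k<N. F (r z * cis (2 * pi * real k / real N)))"
    if "z \<in> space haar_circle" for z
    using that sum_roots_of_power[OF N r(2), of z F] r(1)[of z] unfolding root_average_def by simp
  ultimately show ?thesis by (subst measurable_cong) auto
qed

lemma sum_indicator_equal_parts:
  assumes "N > 0"
  shows "(\<Sum>k<n. indicator {real k / real N ..< real (Suc k) / real N} s :: real)
    = indicator {0 ..< real n / real N} s"
proof (induction n)
  case (Suc n)
  have "real n / real N \<le> real (Suc n) / real N" "0 \<le> real n / real N"
    using assms by (auto simp: divide_right_mono)
  then have "{0 ..< real (Suc n) / real N} = {0 ..< real n / real N} \<union> {real n / real N ..< real (Suc n) / real N}"
    by (intro ivl_disj_un(17)[symmetric])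
  moreover have "{0 ..< real n / real N} \<inter> {real n / real N ..< real (Suc n) / real N} = {}" by auto
  ultimately show ?case
    by (simp only: sum.lessThan_Suc Suc.IH) (simp add: indicator_add)
qed simp

text \<open>
  In the parameter \<open>t \<in> [0, 1)\<close> the \<open>k\<close>-th root of \<open>cis (2 \<pi> t)\<close> is \<open>cis (2 \<pi> (t + k) / N)\<close>, so the
  \<open>k\<close>-th summand, integrated over \<open>t\<close>, is \<open>N\<close> times the integral of \<open>F\<close> over the \<open>k\<close>-th of \<open>N\<close>
  equal arcs.
\<close>

lemma
  fixes F :: "complex \<Rightarrow> complex"
  assumes N: "N > 0" and F: "integrable haar_circle F"
  shows integrable_root_average: "integrable haar_circle (root_average N F)"
    and integral_root_average:
      "(\<integral>z. root_average N F z \<partial>haar_circle) = (\<integral>z. F z \<partial>haar_circle)"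
proof -
  let ?D = "restrict_space lborel {0..<1::real}"
  let ?e = "\<lambda>t::real. cis (2 * pi * t)"
  define G where "G s = indicator {0..<1} s *\<^sub>R F (?e s)" for s :: real
  define I where "I k = {real k / real N ..< real (Suc k) / real N}" for k :: nat
  define Gk where "Gk k s = indicator (I k) s *\<^sub>R G s" for k :: nat and s :: real
  have Fm: "F \<in> borel_measurable haar_circle" using F by auto
  have I_sub: "I k \<subseteq> {0..<1}" if "k < N" for k
    using that N by (auto simp: I_def field_simps)
  have intF: "integrable ?D (\<lambda>t. F (?e t))" and intF_eq: "(\<integral>z. F z \<partial>haar_circle) = (\<integral>t. F (?e t) \<partial>?D)"
    using F Fm unfolding haar_circle_def
    by (auto simp: integrable_distr_eq integral_distr cong: measurable_cong_sets)
  have G: "integrable lborel G" "(\<integral>z. F z \<partial>haar_circle) = (\<integral>s. G s \<partial>lborel)"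
    using intF unfolding intF_eq G_def by (auto simp: integrable_restrict_space integral_restrict_space)
  have Gk: "integrable lborel (Gk k)" for k
    unfolding Gk_def using G(1) by (intro integrable_mult_indicator) (auto simp: I_def)
  have split: "G s = (\<Sum>k<N. Gk k s)" for s
    unfolding Gk_def scaleR_sum_left[symmetric] I_def sum_indicator_equal_parts[OF N]
    using N by (simp add: G_def indicator_def)
  \<comment> \<open>The affine substitution \<open>s = (t + k) / N\<close> maps \<open>[0, 1)\<close> onto the \<open>k\<close>-th subinterval.\<close>
  have shift: "indicator {0..<1} t *\<^sub>R root_average N F (?e t)
      = 1 / of_nat N * (\<Sum>k<N. Gk k (real k / real N + 1 / real N * t))" for t
  proof -
    have *: "Gk k (real k / real N + 1 / real N * t)
      = indicator {0..<1} t *\<^sub>R F (?e (t / real N) * cis (2 * pi * real k / real N))" if "k < N" for k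
    proof -
      have "real k / real N + 1 / real N * t \<in> I k \<longleftrightarrow> t \<in> {0..<1}"
        using N by (auto simp: I_def field_simps)
      moreover have "?e (real k / real N + 1 / real N * t) = ?e (t / real N) * cis (2 * pi * real k / real N)"
        by (simp add: cis_mult algebra_simps)
      ultimately show ?thesis using I_sub[OF that] by (auto simp: Gk_def G_def indicator_def)
    qed
    have "?e t = ?e (t / real N) ^ N" using N by (simp add: Complex.DeMoivre)
    then show ?thesis
      using sum_roots_of_power[OF N, of "?e (t / real N)" F] *
      by (cases "t \<in> {0..<1}") (auto simp: root_average_def)
  qed
  have sh: "integrable lborel (\<lambda>t. Gk k (real k / real N + 1 / real N * t))"
    "(\<integral>t. Gk k (real k / real N + 1 / real N * t) \<partial>lborel) = of_nat N * (\<integral>t. Gk k t \<partial>lborel)" for k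
  proof -
    show "integrable lborel (\<lambda>t. Gk k (real k / real N + 1 / real N * t))"
      using N by (intro lborel_integrable_real_affine Gk) auto
    show "(\<integral>t. Gk k (real k / real N + 1 / real N * t) \<partial>lborel) = of_nat N * (\<integral>t. Gk k t \<partial>lborel)"
      using N by (subst (2) lborel_integral_real_affine[where c = "1 / real N" and t = "real k / real N"])
        (auto simp: scaleR_conv_of_real)
  qed
  have Rm: "root_average N F \<in> borel_measurable haar_circle"
    by (rule root_average_measurable[OF N Fm])
  have "integrable lborel (\<lambda>t. indicator {0..<1} t *\<^sub>R root_average N F (?e t))"
    unfolding shift using sh(1) by auto
  then show "integrable haar_circle (root_average N F)"
    using Rm unfolding haar_circle_def
    by (auto simp: integrable_distr_eq integrable_restrict_space cong: measurable_cong_sets)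
  have "(\<integral>z. root_average N F z \<partial>haar_circle)
      = (\<integral>t. indicator {0..<1} t *\<^sub>R root_average N F (?e t) \<partial>lborel)"
    using Rm unfolding haar_circle_def
    by (auto simp: integral_distr integral_restrict_space cong: measurable_cong_sets)
  also have "\<dots> = 1 / of_nat N * (\<Sum>k<N. of_nat N * (\<integral>t. Gk k t \<partial>lborel))"
    unfolding shift using sh by (simp add: Bochner_Integration.integral_sum)
  also have "\<dots> = (\<integral>s. G s \<partial>lborel)"
    using N Gk unfolding split by (simp add: Bochner_Integration.integral_sum sum_distrib_left[symmetric])
  finally show "(\<integral>z. root_average N F z \<partial>haar_circle) = (\<integral>z. F z \<partial>haar_circle)" using G(2) by simp
qed

lemma circle_power_measurable [measurable]: "(\<lambda>z. z ^ n) \<in> haar_circle \<rightarrow>\<^sub>M haar_circle"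
proof -
  have "(\<lambda>z::complex. z ^ n) \<in> restrict_space borel (sphere 0 1) \<rightarrow>\<^sub>M restrict_space borel (sphere 0 1)"
    by (rule measurable_restrict_space2) (auto simp: norm_power intro!: measurable_restrict_space1)
  then show ?thesis by (simp add: measurable_cong_sets[OF sets_haar_circle sets_haar_circle])
qed

text \<open>
  Haar measure is invariant under \<open>z \<mapsto> z^N\<close>: averaging \<open>f(w^N)\<close> over the roots \<open>w\<close> of \<open>z\<close>
  returns \<open>f(z)\<close>. Applied to the powers \<open>N^j\<close>, this bounds \<open>m\<^sub>0(z^(N^j))\<close> almost everywhere.
\<close>

lemma AE_haar_circle_power:
  assumes N: "N > 0" and "AE z in haar_circle. P z"
  shows "AE z in haar_circle. P (z ^ N)"
proof -
  obtain B where B: "B \<in> sets haar_circle" "emeasure haar_circle B = 0" "{z \<in> sphere 0 1. \<not> P z} \<subseteq> B"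
    using AE_E[OF assms(2)] by auto
  interpret finite_measure haar_circle by (rule finite_measure_haar_circle)
  let ?F = "\<lambda>z. indicator B (z ^ N) :: complex"
  let ?B = "(\<lambda>z. z ^ N) -` B \<inter> space haar_circle"
  have mB: "?B \<in> sets haar_circle" by (rule measurable_sets[OF circle_power_measurable B(1)])
  have F_eq: "(\<lambda>z. indicator B (z ^ N)) = (indicator ((\<lambda>z. z ^ N) -` B) :: complex \<Rightarrow> complex)"
    by (auto simp: indicator_def)
  have intF: "integrable haar_circle ?F"
    using B(1) by (intro integrable_const_bound[where B = 1]) (auto simp: indicator_def)
  have "root_average N ?F z = indicator B z" if "z \<in> space haar_circle" for z
  proof -
    have "z \<noteq> 0" using that by auto
    then have "card {w. w ^ N = z} = N" by (rule card_nth_roots[OF _ N])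
    then show ?thesis using N by (simp add: root_average_def)
  qed
  then have "(\<integral>z. root_average N ?F z \<partial>haar_circle) = (\<integral>z. indicator B z \<partial>haar_circle)"
    by (intro Bochner_Integration.integral_cong) auto
  also have "\<dots> = 0"
    by (rule integral_eq_zero_AE, rule AE_I'[where N = B])
      (use B in \<open>auto simp: null_sets_def indicator_def\<close>)
  finally have "(\<integral>z. ?F z \<partial>haar_circle) = 0" using integral_root_average[OF N intF] by simp
  also have "(\<integral>z. ?F z \<partial>haar_circle) = (\<integral>z. complex_of_real (indicator ?B z) \<partial>haar_circle)"
    by (intro Bochner_Integration.integral_cong) (auto simp: indicator_def)
  finally have "measure haar_circle ?B = 0" using mB by simp
  then have "?B \<in> null_sets haar_circle" using mB by (auto simp: emeasure_eq_measure)
  then show ?thesis by (rule AE_I') (auto simp: norm_power intro!: subsetD[OF B(3)])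
qed

section \<open>Iterates of the transfer operator\<close>

text \<open>
  The density that \<open>i\<close> applications of the transfer operator leave behind under the Haar integral.
\<close>

definition cascade_weight :: "nat \<Rightarrow> (complex \<Rightarrow> complex) \<Rightarrow> nat \<Rightarrow> complex \<Rightarrow> real" where
  "cascade_weight N m0 i z = (\<Prod>j<i. (cmod (m0 (z ^ N ^ j)))\<^sup>2)"

lemma cascade_weight_nonneg: "0 \<le> cascade_weight N m0 i z"
  by (simp add: cascade_weight_def prod_nonneg)

lemma cascade_weight_0 [simp]: "cascade_weight N m0 0 z = 1"
  by (simp add: cascade_weight_def)

lemma cascade_weight_Suc:
  "cascade_weight N m0 (Suc i) z = cascade_weight N m0 i z * (cmod (m0 (z ^ N ^ i)))\<^sup>2"
  by (simp add: cascade_weight_def)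

lemma cascade_weight_Suc_shift:
  "cascade_weight N m0 (Suc i) z = (cmod (m0 z))\<^sup>2 * cascade_weight N m0 i (z ^ N)"
  by (simp add: cascade_weight_def prod.lessThan_Suc_shift power_mult[symmetric] del: prod.lessThan_Suc)

lemma cascade_weight_measurable:
  assumes [measurable]: "m0 \<in> borel_measurable haar_circle"
  shows "cascade_weight N m0 i \<in> borel_measurable haar_circle"
  unfolding cascade_weight_def by measurable

lemma cascade_weight_bounded:
  assumes "N > 0" and "AE z in haar_circle. cmod (m0 z) \<le> C"
  shows "AE z in haar_circle. cascade_weight N m0 i z \<le> C\<^sup>2 ^ i"
proof (induction i)
  case (Suc i)
  have "AE z in haar_circle. cmod (m0 (z ^ N ^ i)) \<le> C"
    using assms by (intro AE_haar_circle_power) auto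
  with Suc.IH show ?case
  proof eventually_elim
    case (elim z)
    then have "cascade_weight N m0 i z * (cmod (m0 (z ^ N ^ i)))\<^sup>2 \<le> C\<^sup>2 ^ i * C\<^sup>2"
      by (intro mult_mono) (auto intro: power_mono simp: cascade_weight_nonneg)
    then show ?case by (simp add: cascade_weight_Suc mult_ac)
  qed
qed simp

lemma integrable_cascade_weight_mult:
  fixes F :: "complex \<Rightarrow> complex"
  assumes N: "N > 0" and m0: "m0 \<in> Linf haar_circle" and F: "integrable haar_circle F"
  shows "integrable haar_circle (\<lambda>z. of_real (cascade_weight N m0 i z) * F z)"
proof -
  obtain C where C: "AE z in haar_circle. cmod (m0 z) \<le> C"
    and m0m: "m0 \<in> borel_measurable haar_circle" using m0 by (auto simp: Linf_def)
  note [measurable] = cascade_weight_measurable[OF m0m] borel_measurable_integrable[OF F]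
  show ?thesis
  proof (rule Bochner_Integration.integrable_bound)
    show "integrable haar_circle (\<lambda>z. (C\<^sup>2) ^ i *\<^sub>R F z)" using F by simp
    show "AE z in haar_circle. norm (of_real (cascade_weight N m0 i z) * F z) \<le> norm ((C\<^sup>2) ^ i *\<^sub>R F z)"
      using cascade_weight_bounded[OF N C, of i]
      by eventually_elim (auto simp: norm_mult cascade_weight_nonneg abs_of_nonneg intro!: mult_right_mono)
  qed measurable
qed

text \<open>
  The recursion starts with the innermost application of the operator: a factor that depends only on
  \<open>z = w^N\<close> moves inside the average, which is why \<open>cascade_weight_Suc_shift\<close> peels off \<open>|m\<^sub>0(z)|\<^sup>2\<close>.
  The measure on the solenoid uses the other recursion, \<open>cascade_weight_Suc\<close>.
\<close>

lemma transfer_op_iterates: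
  fixes F :: "complex \<Rightarrow> complex"
  assumes N: "N > 0" and m0: "m0 \<in> Linf haar_circle" and F: "integrable haar_circle F"
  shows "(\<integral>z. (transfer_op N m0 ^^ i) F z \<partial>haar_circle)
    = (\<integral>z. of_real (cascade_weight N m0 i z) * F z \<partial>haar_circle)"
  using F
proof (induction i arbitrary: F)
  case (Suc i)
  have R: "transfer_op N m0 F = root_average N (\<lambda>w. of_real ((cmod (m0 w))\<^sup>2) * F w)"
    by (auto simp: transfer_op_def root_average_def)
  have "integrable haar_circle (\<lambda>w. of_real (cascade_weight N m0 1 w) * F w)"
    by (rule integrable_cascade_weight_mult[OF N m0 Suc.prems])
  then have "integrable haar_circle (transfer_op N m0 F)"
    unfolding R by (intro integrable_root_average[OF N]) (simp add: cascade_weight_def)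
  then have "(\<integral>z. (transfer_op N m0 ^^ Suc i) F z \<partial>haar_circle)
      = (\<integral>z. of_real (cascade_weight N m0 i z) * transfer_op N m0 F z \<partial>haar_circle)"
    using Suc.IH by (simp add: funpow_swap1)
  also have "(\<lambda>z. of_real (cascade_weight N m0 i z) * transfer_op N m0 F z)
      = root_average N (\<lambda>w. of_real (cascade_weight N m0 (Suc i) w) * F w)"
    by (auto simp: R root_average_def cascade_weight_Suc_shift sum_distrib_left mult_ac intro!: sum.cong)
  also have "(\<integral>z. root_average N (\<lambda>w. of_real (cascade_weight N m0 (Suc i) w) * F w) z \<partial>haar_circle)
      = (\<integral>z. of_real (cascade_weight N m0 (Suc i) z) * F z \<partial>haar_circle)"
    by (rule integral_root_average[OF N integrable_cascade_weight_mult[OF N m0 Suc.prems]])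
  finally show ?case .
qed simp

section \<open>Finite measures on the circle are determined by continuous functions\<close>

text \<open>
  The functions \<open>max 0 (1 - n dist(z, C))\<close> are continuous, bounded by \<open>1\<close>, and decrease to the
  indicator of the nonempty closed set \<open>C\<close>. Closed sets are closed under intersection and generate the Borel sets.
\<close>

lemma finite_measures_on_circle_eqI:
  assumes M: "finite_measure M" "sets M = sets haar_circle"
    and M': "finite_measure M'" "sets M' = sets haar_circle"
    and eq: "\<And>f :: complex \<Rightarrow> complex. continuous_on (sphere 0 1) f \<Longrightarrow> (\<integral>z. f z \<partial>M) = (\<integral>z. f z \<partial>M')"
  shows "M = M'"
proof -
  let ?S = "sphere 0 1 :: complex set"
  let ?E = "(\<inter>) ?S ` Collect closed"
  have "sets (borel :: complex measure) = sigma_sets UNIV (Collect closed)"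
    unfolding borel_eq_closed by (rule sets_measure_of) simp
  then have "sets haar_circle = (\<inter>) ?S ` sigma_sets UNIV (Collect closed)"
    by (simp add: sets_haar_circle sets_restrict_space)
  also have "\<dots> = sigma_sets ?S ?E" by (rule sigma_sets_Int) auto
  finally have sets: "sets haar_circle = sigma_sets ?S ?E" .
  have lim: "(\<lambda>n. \<integral>z. max 0 (1 - real n * infdist z C) \<partial>K) \<longlonglongrightarrow> measure K (?S \<inter> C)"
    if C: "closed C" "C \<noteq> {}" and K: "finite_measure K" "sets K = sets haar_circle" for C K
  proof -
    interpret finite_measure K by (rule K(1))
    have space: "space K = ?S" using sets_eq_imp_space_eq[OF K(2)] by simp
    have meas: "g \<in> borel_measurable K" if "continuous_on UNIV g" for g :: "complex \<Rightarrow> real"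
      using borel_measurable_continuous_onI[OF that]
      by (simp add: measurable_cong_sets[OF K(2) refl] measurable_cong_sets[OF sets_haar_circle refl] measurable_restrict_space1)
    have "?S \<inter> C \<in> sets K" unfolding K(2) sets using C by (intro sigma_sets.Basic) auto
    have "(\<lambda>n. \<integral>z. max 0 (1 - real n * infdist z C) \<partial>K) \<longlonglongrightarrow> (\<integral>z. indicator (?S \<inter> C) z \<partial>K)"
    proof (rule integral_dominated_convergence[where w = "\<lambda>_. 1"])
      show "AE z in K. (\<lambda>n. max 0 (1 - real n * infdist z C)) \<longlonglongrightarrow> indicator (?S \<inter> C) z"
      proof (rule AE_I2)
        fix z assume z: "z \<in> space K"
        show "(\<lambda>n. max 0 (1 - real n * infdist z C)) \<longlonglongrightarrow> indicator (?S \<inter> C) z"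
        proof (cases "z \<in> C")
          case True
          then show ?thesis using z space by simp
        next
          case False
          then have pos: "infdist z C > 0"
            using C infdist_nonneg[of z C] in_closed_iff_infdist_zero[of C z] by force
          obtain n0 where n0: "1 < real n0 * infdist z C" using reals_Archimedean3[OF pos] by blast
          have "max 0 (1 - real n * infdist z C) = 0" if "n \<ge> n0" for n
          proof -
            have "real n0 * infdist z C \<le> real n * infdist z C" using that pos by (intro mult_right_mono) auto
            then show ?thesis using n0 by simp
          qed
          then have "eventually (\<lambda>n. max 0 (1 - real n * infdist z C) = 0) sequentially"
            using eventually_sequentially by blast
          then have "(\<lambda>n. max 0 (1 - real n * infdist z C)) \<longlonglongrightarrow> 0" by (rule tendsto_eventually)
          then show ?thesis using False by simp
        qed
      qed
      show "AE z in K. norm (max 0 (1 - real n * infdist z C)) \<le> 1" for n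
        using infdist_nonneg[of _ C] by (intro AE_I2) simp
      show "(\<lambda>z. max 0 (1 - real n * infdist z C)) \<in> borel_measurable K" for n
        by (rule meas) (intro continuous_intros)
    qed (use \<open>?S \<inter> C \<in> sets K\<close> in auto)
    then show ?thesis using \<open>?S \<inter> C \<in> sets K\<close> by simp
  qed
  show ?thesis
  proof (rule measure_eqI_generator_eq[where \<Omega> = ?S and E = ?E and A = "\<lambda>_. ?S"])
    show "Int_stable ?E"
    proof (rule Int_stableI)
      fix a b assume "a \<in> ?E" "b \<in> ?E"
      then obtain A B where "closed A" "closed B" "a \<inter> b = ?S \<inter> (A \<inter> B)" by auto
      then show "a \<inter> b \<in> ?E" by (auto intro!: imageI)
    qed
    have "?S \<inter> UNIV \<in> ?E" by (intro imageI) simp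
    then show "range (\<lambda>_::nat. ?S) \<subseteq> ?E" by simp
    show "emeasure M ?S \<noteq> \<infinity>" using finite_measure.emeasure_finite[OF M(1)] by simp
    fix X assume "X \<in> ?E"
    then obtain C where C: "closed C" and X: "X = ?S \<inter> C" by auto
    have "measure M X = measure M' X"
    proof (cases "C = {}")
      case False
      have "(\<integral>z. max 0 (1 - real n * infdist z C) \<partial>M) = (\<integral>z. max 0 (1 - real n * infdist z C) \<partial>M')" for n
      proof -
        have "(\<integral>z. complex_of_real (max 0 (1 - real n * infdist z C)) \<partial>M)
            = (\<integral>z. complex_of_real (max 0 (1 - real n * infdist z C)) \<partial>M')"
          by (rule eq) (intro continuous_intros)
        then show ?thesis by (simp only: integral_complex_of_real of_real_eq_iff)
      qed
      then have "(\<lambda>n. \<integral>z. max 0 (1 - real n * infdist z C) \<partial>M) \<longlonglongrightarrow> measure M' X"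
        using lim[OF C False M'] X by simp
      then show ?thesis using lim[OF C False M] X by (simp add: LIMSEQ_unique)
    qed (simp add: X)
    then show "emeasure M X = emeasure M' X"
      using M(1) M'(1) by (simp add: finite_measure.emeasure_eq_measure)
  qed (auto simp: M M' sets)
qed

section \<open>Bounded operators between \<open>L\<^sup>2\<close> spaces\<close>

lemma borel_measurable_cnj [measurable (raw)]:
  "f \<in> borel_measurable M \<Longrightarrow> (\<lambda>x. cnj (f x)) \<in> borel_measurable M"
  by (rule borel_measurable_continuous_on[OF continuous_on_cnj[OF continuous_on_id]])

lemma L2_measurable: "f \<in> L2 M \<Longrightarrow> f \<in> borel_measurable M"
  by (simp add: L2_def)

lemma L2_integrable: "f \<in> L2 M \<Longrightarrow> integrable M (\<lambda>x. (cmod (f x))\<^sup>2)"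
  by (simp add: L2_def)

lemma L2_dominated:
  assumes "g \<in> L2 M" "f \<in> borel_measurable M" "\<And>x. x \<in> space M \<Longrightarrow> cmod (f x) \<le> C * cmod (g x)"
  shows "f \<in> L2 M"
proof -
  have "integrable M (\<lambda>x. (cmod (f x))\<^sup>2)"
  proof (rule Bochner_Integration.integrable_bound)
    show "integrable M (\<lambda>x. C\<^sup>2 * (cmod (g x))\<^sup>2)" using L2_integrable[OF assms(1)] by simp
    show "AE x in M. norm ((cmod (f x))\<^sup>2) \<le> norm (C\<^sup>2 * (cmod (g x))\<^sup>2)"
      using assms(3) power_mono[OF assms(3) norm_ge_zero, of _ 2] by (auto simp: power_mult_distrib)
  qed (use assms(2) in measurable)
  with assms(2) show ?thesis by (simp add: L2_def)
qed

lemma cmod_sum_sq_le: "(cmod (u + v))\<^sup>2 \<le> 2 * (cmod u)\<^sup>2 + 2 * (cmod v)\<^sup>2"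
proof -
  have "(cmod (u + v))\<^sup>2 \<le> (cmod u + cmod v)\<^sup>2" by (intro power_mono norm_triangle_ineq norm_ge_zero)
  moreover have "0 \<le> (cmod u - cmod v)\<^sup>2" by simp
  ultimately show ?thesis by (simp add: power2_eq_square algebra_simps)
qed

lemma L2_lincomb:
  assumes "f \<in> L2 M" "g \<in> L2 M"
  shows "(\<lambda>x. a * f x + b * g x) \<in> L2 M"
proof -
  note [measurable] = assms[THEN L2_measurable]
  have "integrable M (\<lambda>x. (cmod (a * f x + b * g x))\<^sup>2)"
  proof (rule Bochner_Integration.integrable_bound)
    show "integrable M (\<lambda>x. 2 * ((cmod a)\<^sup>2 * (cmod (f x))\<^sup>2) + 2 * ((cmod b)\<^sup>2 * (cmod (g x))\<^sup>2))"
      using assms[THEN L2_integrable] by auto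
    show "AE x in M. norm ((cmod (a * f x + b * g x))\<^sup>2)
        \<le> norm (2 * ((cmod a)\<^sup>2 * (cmod (f x))\<^sup>2) + 2 * ((cmod b)\<^sup>2 * (cmod (g x))\<^sup>2))"
      using cmod_sum_sq_le[of "a * f _" "b * g _"] by (auto simp: norm_mult power_mult_distrib)
  qed measurable
  then show ?thesis by (simp add: L2_def)
qed

lemma L2_norm_sq: "(L2_norm M f)\<^sup>2 = (\<integral>x. (cmod (f x))\<^sup>2 \<partial>M)"
  by (simp add: L2_norm_def)

lemma L2_norm_cong_AE:
  assumes "f \<in> borel_measurable M" "g \<in> borel_measurable M" "AE x in M. f x = g x"
  shows "L2_norm M f = L2_norm M g"
  unfolding L2_norm_def
  by (intro arg_cong[where f = sqrt] integral_cong_AE) (use assms in \<open>auto elim: eventually_mono\<close>)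

lemma (in finite_measure) L2_indicator:
  assumes "A \<in> sets M" shows "(indicator A :: _ \<Rightarrow> complex) \<in> L2 M"
proof -
  have "integrable M (\<lambda>x. (cmod (indicator A x))\<^sup>2)"
    using assms by (intro integrable_const_bound[where B = 1]) (auto simp: indicator_def)
  with assms show ?thesis by (simp add: L2_def)
qed

lemma L2_isometry_imp_bounded: "L2_isometry M M' T \<Longrightarrow> L2_bounded_operator M M' T"
  unfolding L2_isometry_def L2_bounded_operator_def by (auto intro!: exI[of _ 1])

text \<open>
  Two bounded operators are compared through the set of functions on which they agree. This set is
  closed under linear combinations and dominated limits, so it is everything as soon as it contains the
  indicators of an intersection-stable generator of the \<open>\<sigma>\<close>-algebra.
\<close>

locale L2_operator_pair =
  fixes M :: "'a measure" and M' :: "'b measure" and S T :: "('a \<Rightarrow> complex) \<Rightarrow> 'b \<Rightarrow> complex"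
  assumes S: "L2_bounded_operator M M' S" and T: "L2_bounded_operator M M' T"
begin

definition agree :: "('a \<Rightarrow> complex) set" where
  "agree = {f \<in> L2 M. AE y in M'. T f y = S f y}"

lemma agree_L2: "f \<in> agree \<Longrightarrow> f \<in> L2 M"
  by (simp add: agree_def)

lemma agree_lincomb:
  assumes "f \<in> agree" "g \<in> agree"
  shows "(\<lambda>x. a * f x + b * g x) \<in> agree"
proof -
  have f: "f \<in> L2 M" and g: "g \<in> L2 M" using assms by (auto simp: agree_def)
  have "AE y in M'. T (\<lambda>x. a * f x + b * g x) y = a * T f y + b * T g y"
    "AE y in M'. S (\<lambda>x. a * f x + b * g x) y = a * S f y + b * S g y"
    using S T f g by (auto simp: L2_bounded_operator_def L2_linear_def)
  moreover have "AE y in M'. T f y = S f y" "AE y in M'. T g y = S g y"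
    using assms by (auto simp: agree_def)
  ultimately have "AE y in M'. T (\<lambda>x. a * f x + b * g x) y = S (\<lambda>x. a * f x + b * g x) y"
    by eventually_elim simp
  then show ?thesis using L2_lincomb[OF f g] by (simp add: agree_def)
qed

lemma agree_sum:
  assumes "finite I" "(\<lambda>_. 0) \<in> agree" "\<And>i. i \<in> I \<Longrightarrow> f i \<in> agree"
  shows "(\<lambda>x. \<Sum>i\<in>I. c i * f i x) \<in> agree"
  using assms(1,3)
proof (induction I rule: finite_induct)
  case (insert i I)
  then have "(\<lambda>x. c i * f i x + 1 * (\<Sum>i\<in>I. c i * f i x)) \<in> agree"
    by (intro agree_lincomb) auto
  then show ?case using insert by simp
qed (use assms(2) in simp)

lemma operator_norm_sq_bound:
  assumes "L2_bounded_operator M M' R"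
  obtains C where "\<And>f. f \<in> L2 M \<Longrightarrow> (\<integral>y. (cmod (R f y))\<^sup>2 \<partial>M') \<le> C\<^sup>2 * (\<integral>x. (cmod (f x))\<^sup>2 \<partial>M)"
proof -
  obtain C where C: "\<And>f. f \<in> L2 M \<Longrightarrow> L2_norm M' (R f) \<le> C * L2_norm M f"
    using assms by (auto simp: L2_bounded_operator_def)
  show ?thesis
  proof (rule that[of C])
    fix f assume "f \<in> L2 M"
    from C[OF this] have "(L2_norm M' (R f))\<^sup>2 \<le> (C * L2_norm M f)\<^sup>2"
      by (rule power_mono) (simp add: L2_norm_def)
    then show "(\<integral>y. (cmod (R f y))\<^sup>2 \<partial>M') \<le> C\<^sup>2 * (\<integral>x. (cmod (f x))\<^sup>2 \<partial>M)"
      by (simp add: power_mult_distrib L2_norm_sq)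
  qed
qed

text \<open>
  With \<open>d\<^sub>n = F - s\<^sub>n\<close>, agreement on \<open>s\<^sub>n\<close> gives \<open>T F - S F = T d\<^sub>n - S d\<^sub>n\<close>, whose norm is controlled
  by that of \<open>d\<^sub>n\<close>, and \<open>d\<^sub>n\<close> tends to zero in \<open>L\<^sup>2\<close> by dominated convergence.
\<close>

lemma agree_dominated_limit:
  assumes F: "F \<in> L2 M" and s: "\<And>n. s n \<in> agree"
    and lim: "\<And>x. x \<in> space M \<Longrightarrow> (\<lambda>n. s n x) \<longlonglongrightarrow> F x"
    and bound: "\<And>n x. x \<in> space M \<Longrightarrow> cmod (s n x) \<le> C * cmod (F x)"
  shows "F \<in> agree"
proof -
  obtain A where A: "\<And>f. f \<in> L2 M \<Longrightarrow> (\<integral>y. (cmod (S f y))\<^sup>2 \<partial>M') \<le> A\<^sup>2 * (\<integral>x. (cmod (f x))\<^sup>2 \<partial>M)"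
    using operator_norm_sq_bound[OF S] by blast
  obtain B where B: "\<And>f. f \<in> L2 M \<Longrightarrow> (\<integral>y. (cmod (T f y))\<^sup>2 \<partial>M') \<le> B\<^sup>2 * (\<integral>x. (cmod (f x))\<^sup>2 \<partial>M)"
    using operator_norm_sq_bound[OF T] by blast
  note sL = agree_L2[OF s]
  note [measurable] = L2_measurable[OF F] L2_measurable[OF sL]
  define d where "d n x = 1 * F x + (- 1) * s n x" for n x
  have d: "d n \<in> L2 M" for n unfolding d_def by (rule L2_lincomb[OF F sL])
  have lin: "L2_linear M M' S" "L2_linear M M' T" using S T by (auto simp: L2_bounded_operator_def)
  then have maps: "S f \<in> L2 M'" "T f \<in> L2 M'" if "f \<in> L2 M" for f using that by (auto simp: L2_linear_def)
  define K where "K = 2 * B\<^sup>2 + 2 * A\<^sup>2"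
  \<comment> \<open>Coefficients are written out so that \<open>L2_lincomb\<close> applies; this is \<open>T F - S F\<close>.\<close>
  have TS: "(\<lambda>y. 1 * T F y + (- 1) * S F y) \<in> L2 M'" by (intro L2_lincomb maps F)
  have est: "(\<integral>y. (cmod (T F y - S F y))\<^sup>2 \<partial>M') \<le> K * (\<integral>x. (cmod (d n x))\<^sup>2 \<partial>M)" for n
  proof -
    have "AE y in M'. T (d n) y = 1 * T F y + (- 1) * T (s n) y"
      "AE y in M'. S (d n) y = 1 * S F y + (- 1) * S (s n) y"
      using lin F sL[of n] unfolding d_def L2_linear_def by blast+
    moreover have "AE y in M'. T (s n) y = S (s n) y" using s[of n] by (simp add: agree_def)
    ultimately have "AE y in M'. (cmod (T F y - S F y))\<^sup>2 \<le> 2 * (cmod (T (d n) y))\<^sup>2 + 2 * (cmod (S (d n) y))\<^sup>2"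
    proof eventually_elim
      case (elim y)
      then have "T F y - S F y = T (d n) y + (- S (d n) y)" by simp
      then show ?case using cmod_sum_sq_le[of "T (d n) y" "- S (d n) y"] by simp
    qed
    then have "(\<integral>y. (cmod (T F y - S F y))\<^sup>2 \<partial>M')
        \<le> (\<integral>y. 2 * (cmod (T (d n) y))\<^sup>2 + 2 * (cmod (S (d n) y))\<^sup>2 \<partial>M')"
      using L2_integrable[OF TS] L2_integrable[OF maps(1)[OF d]] L2_integrable[OF maps(2)[OF d]]
      by (intro integral_mono_AE) auto
    also have "\<dots> = 2 * (\<integral>y. (cmod (T (d n) y))\<^sup>2 \<partial>M') + 2 * (\<integral>y. (cmod (S (d n) y))\<^sup>2 \<partial>M')"
      using L2_integrable[OF maps(1)[OF d]] L2_integrable[OF maps(2)[OF d]] by simp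
    also have "\<dots> \<le> K * (\<integral>x. (cmod (d n x))\<^sup>2 \<partial>M)"
      using A[OF d, of n] B[OF d, of n] by (simp add: K_def algebra_simps)
    finally show ?thesis .
  qed
  have "(\<lambda>n. \<integral>x. (cmod (d n x))\<^sup>2 \<partial>M) \<longlonglongrightarrow> (\<integral>x. 0 \<partial>M)"
  proof (rule integral_dominated_convergence)
    show "integrable M (\<lambda>x. ((1 + C) * cmod (F x))\<^sup>2)" using L2_integrable[OF F] by (simp add: power_mult_distrib)
    show "AE x in M. (\<lambda>n. (cmod (d n x))\<^sup>2) \<longlonglongrightarrow> 0"
    proof (rule AE_I2)
      fix x assume "x \<in> space M"
      have "(\<lambda>n. (cmod (F x - s n x))\<^sup>2) \<longlonglongrightarrow> (cmod (F x - F x))\<^sup>2"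
        by (intro tendsto_intros lim \<open>x \<in> space M\<close>)
      then show "(\<lambda>n. (cmod (d n x))\<^sup>2) \<longlonglongrightarrow> 0" by (simp add: d_def)
    qed
    show "AE x in M. norm ((cmod (d n x))\<^sup>2) \<le> ((1 + C) * cmod (F x))\<^sup>2" for n
    proof (rule AE_I2)
      fix x assume x: "x \<in> space M"
      have "cmod (d n x) \<le> cmod (F x) + cmod (s n x)" by (simp add: d_def norm_triangle_ineq4)
      also have "\<dots> \<le> (1 + C) * cmod (F x)" using bound[OF x, of n] by (simp add: algebra_simps)
      finally show "norm ((cmod (d n x))\<^sup>2) \<le> ((1 + C) * cmod (F x))\<^sup>2" by (auto intro: power_mono)
    qed
  qed (use d in \<open>auto simp: L2_def\<close>)
  then have "(\<lambda>n. K * (\<integral>x. (cmod (d n x))\<^sup>2 \<partial>M)) \<longlonglongrightarrow> K * 0"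
    by (intro tendsto_mult tendsto_const) simp
  then have "(\<integral>y. (cmod (T F y - S F y))\<^sup>2 \<partial>M') \<le> K * 0"
    by (rule LIMSEQ_le_const) (use est in auto)
  moreover have "0 \<le> (\<integral>y. (cmod (T F y - S F y))\<^sup>2 \<partial>M')" by simp
  ultimately have "(\<integral>y. (cmod (T F y - S F y))\<^sup>2 \<partial>M') = 0" by simp
  then have "AE y in M'. (cmod (T F y - S F y))\<^sup>2 = 0"
    using L2_integrable[OF TS] by (subst (asm) integral_nonneg_eq_0_iff_AE) auto
  then have "AE y in M'. T F y = S F y" by eventually_elim simp
  then show ?thesis using F by (simp add: agree_def)
qed

lemma L2_subset_agree:
  assumes fin: "finite_measure M"
    and E: "Int_stable E" "E \<subseteq> Pow (space M)" "sets M = sigma_sets (space M) E" "space M \<in> E"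
    and ind: "\<And>A. A \<in> E \<Longrightarrow> indicator A \<in> agree"
  shows "L2 M \<subseteq> agree"
proof
  interpret finite_measure M by fact
  have one: "indicator (space M) \<in> agree" by (rule ind[OF E(4)])
  have zero: "(\<lambda>_. 0) \<in> agree" using agree_lincomb[OF one one, of 0 0] by simp
  have ind': "indicator A \<in> agree" if "A \<in> sets M" for A
  proof -
    have "A \<in> sigma_sets (space M) E" using that E(3) by simp
    from E(1,2) this show ?thesis
    proof (induction rule: sigma_sets_induct_disjoint)
      case (basic A) then show ?case by (rule ind)
    next
      case empty then show ?case using zero by (simp add: indicator_def[abs_def])
    next
      case (compl A)
      have c: "(\<lambda>x. 1 * indicator (space M) x + (- 1) * indicator A x) \<in> agree"
        by (rule agree_lincomb[OF one compl(2)])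
      have "A \<subseteq> space M" using compl(1) E(3) sets.sets_into_space by blast
      then have "(\<lambda>x. 1 * indicator (space M) x + (- 1) * indicator A x) = (indicator (space M - A) :: _ \<Rightarrow> complex)"
        by (auto simp: indicator_def fun_eq_iff)
      with c show ?case by simp
    next
      case (union A)
      have A: "A i \<in> sets M" for i using union(2) E(3) by auto
      let ?s = "\<lambda>n x. \<Sum>i<n. 1 * indicator (A i) x :: complex"
      have s_eq: "?s n x = indicator (\<Union>i<n. A i) x" for n x
        using union(1) by (simp add: indicator_UN_disjoint disjoint_family_on_mono[OF subset_UNIV])
      show ?case
      proof (rule agree_dominated_limit[where s = ?s and C = 1])
        show "indicator (\<Union> (range A)) \<in> L2 M" using A by (intro L2_indicator) auto
        show "?s n \<in> agree" for n by (intro agree_sum zero union(3)) auto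
        show "(\<lambda>n. ?s n x) \<longlonglongrightarrow> indicator (\<Union> (range A)) x" for x
          unfolding s_eq by (rule LIMSEQ_indicator_UN)
        show "cmod (?s n x) \<le> 1 * cmod (indicator (\<Union> (range A)) x)" for n x
          unfolding s_eq by (auto simp: indicator_def)
      qed
    qed
  qed
  fix F assume F: "F \<in> L2 M"
  obtain s where s: "\<And>n. simple_function M (s n)" "\<And>x. x \<in> space M \<Longrightarrow> (\<lambda>n. s n x) \<longlonglongrightarrow> F x"
    "\<And>n x. x \<in> space M \<Longrightarrow> dist (s n x) 0 \<le> 2 * dist (F x) 0"
    using borel_measurable_implies_sequence_metric[OF L2_measurable[OF F], of 0] by blast
  let ?t = "\<lambda>n x. \<Sum>y\<in>s n ` space M. y * indicator (s n -` {y} \<inter> space M) x"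
  have t: "?t n x = s n x" if "x \<in> space M" for n x
  proof -
    have "?t n x = (\<Sum>y\<in>s n ` space M. if s n x = y then y else 0)"
      using that by (intro sum.cong) (auto simp: indicator_def)
    also have "\<dots> = s n x" using that s(1)[of n] by (subst sum.delta') (auto simp: simple_function_def)
    finally show ?thesis .
  qed
  show "F \<in> agree"
  proof (rule agree_dominated_limit[OF F, where s = ?t and C = 2])
    show "?t n \<in> agree" for n
      using s(1)[of n] by (intro agree_sum zero ind') (auto simp: simple_function_def)
  qed (use s t in auto)
qed

end

text \<open>
  If \<open>T\<close> extends \<open>S\<close> then so does each power, \<open>T\<^sup>n J = J S\<^sup>n\<close>, and \<open>J\<close> preserves inner products.
\<close>

lemma L2_extension_imp_power_dilation:
  assumes J: "L2_isometry M M' J" and S: "L2_linear M M S" and T: "L2_linear M' M' T"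
    and ext: "L2_extension M M' J S T"
    and inner: "\<And>\<xi> \<eta>. \<xi> \<in> L2 M \<Longrightarrow> \<eta> \<in> L2 M \<Longrightarrow> L2_inner M' (J \<eta>) (J \<xi>) = L2_inner M \<eta> \<xi>"
  shows "L2_power_dilation M M' J S T"
  unfolding L2_power_dilation_def
proof (intro allI ballI)
  have J_L2: "J \<xi> \<in> L2 M'" if "\<xi> \<in> L2 M" for \<xi> using J that by (simp add: L2_isometry_def L2_linear_def)
  have iter: "(S ^^ n) \<xi> \<in> L2 M \<and> (T ^^ n) (J \<xi>) \<in> L2 M' \<and> (AE y in M'. (T ^^ n) (J \<xi>) y = J ((S ^^ n) \<xi>) y)"
    if \<xi>: "\<xi> \<in> L2 M" for n \<xi>
  proof (induction n)
    case 0 then show ?case using \<xi> J_L2 by simp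
  next
    case (Suc n)
    then have S': "(S ^^ n) \<xi> \<in> L2 M" and T': "(T ^^ n) (J \<xi>) \<in> L2 M'"
      and eq: "AE y in M'. (T ^^ n) (J \<xi>) y = J ((S ^^ n) \<xi>) y" by auto
    have "AE y in M'. T ((T ^^ n) (J \<xi>)) y = T (J ((S ^^ n) \<xi>)) y"
      using T T' J_L2[OF S'] eq by (simp add: L2_linear_def)
    moreover have "AE y in M'. T (J ((S ^^ n) \<xi>)) y = J (S ((S ^^ n) \<xi>)) y"
      using ext S' by (simp add: L2_extension_def)
    ultimately have "AE y in M'. T ((T ^^ n) (J \<xi>)) y = J (S ((S ^^ n) \<xi>)) y" by eventually_elim simp
    then show ?case using S T S' T' by (simp add: L2_linear_def)
  qed
  fix n \<xi> \<eta> assume \<xi>: "\<xi> \<in> L2 M" and \<eta>: "\<eta> \<in> L2 M"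
  note it = iter[OF \<xi>, of n]
  note [measurable] = L2_measurable[OF J_L2[OF \<eta>]] L2_measurable[OF conjunct1[OF conjunct2[OF it]]]
    L2_measurable[OF J_L2[OF conjunct1[OF it]]]
  have "L2_inner M' (J \<eta>) ((T ^^ n) (J \<xi>)) = L2_inner M' (J \<eta>) (J ((S ^^ n) \<xi>))"
    unfolding L2_inner_def
  proof (rule integral_cong_AE)
    show "AE y in M'. cnj (J \<eta> y) * (T ^^ n) (J \<xi>) y = cnj (J \<eta> y) * J ((S ^^ n) \<xi>) y"
      using it by (auto elim: eventually_mono)
    show "(\<lambda>y. cnj (J \<eta> y) * (T ^^ n) (J \<xi>) y) \<in> borel_measurable M'"
      "(\<lambda>y. cnj (J \<eta> y) * J ((S ^^ n) \<xi>) y) \<in> borel_measurable M'"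
      by measurable
  qed
  also have "\<dots> = L2_inner M \<eta> ((S ^^ n) \<xi>)" using inner it \<eta> by simp
  finally show "L2_inner M' (J \<eta>) ((T ^^ n) (J \<xi>)) = L2_inner M \<eta> ((S ^^ n) \<xi>)" .
qed

section \<open>The solenoid, its shift and its Borel sets\<close>

text \<open>
  A character of \<open>\<int>[1/N]\<close> is a sequence of points \<open>z\<^sub>i = \<psi> (N^(-i))\<close> on the circle with
  \<open>z\<^bsub>i+1\<^esub>^N = z\<^sub>i\<close>. Each coordinate is thus a function of any later one, so every finite set of
  conditions on coordinates is a condition on a single one.
\<close>

abbreviation coord :: "nat \<Rightarrow> nat \<Rightarrow> (rat \<Rightarrow> complex) \<Rightarrow> complex" where
  "coord N i \<psi> \<equiv> \<psi> (1 / of_nat N ^ i)"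

definition cylinder :: "nat \<Rightarrow> nat \<Rightarrow> complex set \<Rightarrow> (rat \<Rightarrow> complex) set" where
  "cylinder N i B = {\<psi> \<in> solenoid N. coord N i \<psi> \<in> B}"

definition cylinders :: "nat \<Rightarrow> (rat \<Rightarrow> complex) set set" where
  "cylinders N = {cylinder N i B | i B. B \<in> sets borel}"

text \<open>
  The maps dual to multiplication and division by \<open>N\<close> on \<open>\<int>[1/N]\<close>. They are restricted because
  characters have the default value outside the group.
\<close>

definition shift :: "nat \<Rightarrow> (rat \<Rightarrow> complex) \<Rightarrow> rat \<Rightarrow> complex" where
  "shift N \<psi> = restrict (\<lambda>x. \<psi> (of_nat N * x)) (Z_inv N)"

definition unshift :: "nat \<Rightarrow> (rat \<Rightarrow> complex) \<Rightarrow> rat \<Rightarrow> complex" where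
  "unshift N \<psi> = restrict (\<lambda>x. \<psi> (x / of_nat N)) (Z_inv N)"

lemma Z_inv_memI: "of_int k / of_nat N ^ i \<in> Z_inv N"
  by (auto simp: Z_inv_def)

lemma Z_inv_inverse_power [simp]: "1 / of_nat N ^ i \<in> Z_inv N"
  using Z_inv_memI[of 1 N i] by simp

lemma Z_inv_mult: "x \<in> Z_inv N \<Longrightarrow> of_nat N * x \<in> Z_inv N"
proof -
  assume "x \<in> Z_inv N"
  then obtain k i where "x = of_int k / of_nat N ^ i" by (auto simp: Z_inv_def)
  then have "of_nat N * x = of_int (int N * k) / of_nat N ^ i" by simp
  then show ?thesis using Z_inv_memI by metis
qed

lemma Z_inv_div: "x \<in> Z_inv N \<Longrightarrow> x / of_nat N \<in> Z_inv N"
proof -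
  assume "x \<in> Z_inv N"
  then obtain k i where "x = of_int k / of_nat N ^ i" by (auto simp: Z_inv_def)
  then have "x / of_nat N = of_int k / of_nat N ^ Suc i" by simp
  then show ?thesis using Z_inv_memI by metis
qed

lemma Z_inv_add: 
  assumes N: "N > 0" and "x \<in> Z_inv N" "y \<in> Z_inv N" shows "x + y \<in> Z_inv N"
proof -
  obtain k i l j where xy: "x = of_int k / of_nat N ^ i" "y = of_int l / of_nat N ^ j"
    using assms by (auto simp: Z_inv_def)
  have "x + y = of_int (k * int N ^ j + l * int N ^ i) / of_nat N ^ (i + j)"
    unfolding xy using N by (simp add: add_frac_eq power_add)
  then show ?thesis using Z_inv_memI by metis
qed

lemma solenoid_sphere: "\<psi> \<in> solenoid N \<Longrightarrow> x \<in> Z_inv N \<Longrightarrow> \<psi> x \<in> sphere 0 1"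
  unfolding solenoid_def by blast

lemma solenoid_add: "\<psi> \<in> solenoid N \<Longrightarrow> x \<in> Z_inv N \<Longrightarrow> y \<in> Z_inv N \<Longrightarrow> \<psi> (x + y) = \<psi> x * \<psi> y"
  unfolding solenoid_def by blast

lemma solenoid_outside: "\<psi> \<in> solenoid N \<Longrightarrow> x \<notin> Z_inv N \<Longrightarrow> \<psi> x = undefined"
  unfolding solenoid_def by (auto simp: PiE_def extensional_def)

lemma solenoid_nonzero: "\<psi> \<in> solenoid N \<Longrightarrow> x \<in> Z_inv N \<Longrightarrow> \<psi> x \<noteq> 0"
  using solenoid_sphere by fastforce

lemma solenoid_zero: "\<psi> \<in> solenoid N \<Longrightarrow> \<psi> 0 = 1"
  using solenoid_add[of \<psi> N 0 0] solenoid_nonzero[of \<psi> N 0] Z_inv_memI[of 0 N 0] by simp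

lemma solenoid_of_nat_mult:
  assumes N: "N > 0" and "\<psi> \<in> solenoid N" "x \<in> Z_inv N"
  shows "of_nat n * x \<in> Z_inv N \<and> \<psi> (of_nat n * x) = \<psi> x ^ n"
proof (induction n)
  case 0
  then show ?case using Z_inv_memI[of 0 N 0] solenoid_zero assms by simp
next
  case (Suc n)
  have "of_nat (Suc n) * x = x + of_nat n * x" by (simp add: algebra_simps)
  then show ?case using Suc.IH Z_inv_add[OF N assms(3)] solenoid_add[OF assms(2,3)] by simp
qed

lemma solenoid_of_int_mult:
  assumes N: "N > 0" and \<psi>: "\<psi> \<in> solenoid N" and x: "x \<in> Z_inv N"
  shows "\<psi> (of_int k * x) = \<psi> x powi k"
proof (cases "k \<ge> 0")
  case True
  then show ?thesis
    using solenoid_of_nat_mult[OF assms, of "nat k"] by (simp add: power_int_def)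
next
  case False
  let ?n = "nat (- k)"
  have n: "of_nat ?n * x \<in> Z_inv N" "\<psi> (of_nat ?n * x) = \<psi> x ^ ?n"
    using solenoid_of_nat_mult[OF assms] by auto
  obtain l i where "x = of_int l / of_nat N ^ i" using x by (auto simp: Z_inv_def)
  then have "of_int k * x = of_int (k * l) / of_nat N ^ i" by simp
  then have k: "of_int k * x \<in> Z_inv N" using Z_inv_memI by metis
  have "of_int k * x + of_nat ?n * x = 0" using False by (simp add: algebra_simps)
  then have "\<psi> (of_int k * x) * \<psi> x ^ ?n = 1"
    using solenoid_add[OF \<psi> k n(1)] n(2) solenoid_zero[OF \<psi>] by simp
  then have "\<psi> (of_int k * x) = inverse (\<psi> x ^ ?n)"
    using solenoid_nonzero[OF \<psi> x] by (simp add: field_simps)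
  then show ?thesis using False by (simp add: power_int_def power_inverse)
qed

lemma coord_sphere: "\<psi> \<in> solenoid N \<Longrightarrow> cmod (coord N i \<psi>) = 1"
  using solenoid_sphere[of \<psi> N "1 / of_nat N ^ i"] by simp

lemma coord_add_power:
  assumes N: "N > 0" and \<psi>: "\<psi> \<in> solenoid N"
  shows "coord N (i + j) \<psi> ^ N ^ j = coord N i \<psi>"
proof -
  have "of_nat (N ^ j) * (1 / of_nat N ^ (i + j)) = (1 / of_nat N ^ i :: rat)"
    using N by (simp add: power_add)
  then show ?thesis using solenoid_of_nat_mult[OF N \<psi>, of "1 / of_nat N ^ (i + j)" "N ^ j"] by simp
qed

lemma coord_shift: "N > 0 \<Longrightarrow> coord N (Suc i) (shift N \<psi>) = coord N i \<psi>"
  using Z_inv_inverse_power[of N "Suc i"] by (simp add: shift_def del: Z_inv_inverse_power)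

lemma coord_unshift: "coord N i (unshift N \<psi>) = coord N (Suc i) \<psi>"
  using Z_inv_inverse_power[of N i] by (simp add: unshift_def field_simps del: Z_inv_inverse_power)

lemma shift_solenoid:
  assumes "\<psi> \<in> solenoid N" "N > 0" shows "shift N \<psi> \<in> solenoid N"
proof -
  have "shift N \<psi> (x + y) = shift N \<psi> x * shift N \<psi> y" if "x \<in> Z_inv N" "y \<in> Z_inv N" for x y
    using that assms solenoid_add[OF assms(1) Z_inv_mult Z_inv_mult] 
    by (simp add: shift_def Z_inv_add distrib_left)
  moreover have "shift N \<psi> \<in> Z_inv N \<rightarrow>\<^sub>E sphere 0 1"
    using solenoid_sphere[OF assms(1) Z_inv_mult] by (auto simp: shift_def)
  ultimately show ?thesis by (auto simp: solenoid_def)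
qed

lemma unshift_solenoid:
  assumes "\<psi> \<in> solenoid N" "N > 0" shows "unshift N \<psi> \<in> solenoid N"
proof -
  have "unshift N \<psi> (x + y) = unshift N \<psi> x * unshift N \<psi> y" if "x \<in> Z_inv N" "y \<in> Z_inv N" for x y
    using that assms solenoid_add[OF assms(1) Z_inv_div Z_inv_div] 
    by (simp add: unshift_def Z_inv_add add_divide_distrib)
  moreover have "unshift N \<psi> \<in> Z_inv N \<rightarrow>\<^sub>E sphere 0 1"
    using solenoid_sphere[OF assms(1) Z_inv_div] by (auto simp: unshift_def)
  ultimately show ?thesis by (auto simp: solenoid_def)
qed

lemma unshift_shift:
  assumes "\<psi> \<in> solenoid N" "N > 0"
  shows "unshift N (shift N \<psi>) = \<psi>"
proof
  fix x show "unshift N (shift N \<psi>) x = \<psi> x"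
    using assms by (cases "x \<in> Z_inv N") (auto simp: unshift_def shift_def Z_inv_div solenoid_outside)
qed

lemma topspace_solenoid_top: "topspace (solenoid_top N) = solenoid N"
  by (force simp: solenoid_top_def solenoid_def)

lemma solenoid_opens_Pow: "{V. openin (solenoid_top N) V} \<subseteq> Pow (solenoid N)"
  using openin_subset[of "solenoid_top N"] by (auto simp: topspace_solenoid_top)

lemma space_solenoid_borel [simp]: "space (solenoid_borel N) = solenoid N"
  unfolding solenoid_borel_def by (rule space_measure_of[OF solenoid_opens_Pow])

lemma sets_solenoid_borel_opens:
  "sets (solenoid_borel N) = sigma_sets (solenoid N) {V. openin (solenoid_top N) V}"
  unfolding solenoid_borel_def by (rule sets_measure_of[OF solenoid_opens_Pow])

text \<open>
  The space \<open>rat \<Rightarrow> complex\<close> is a countable product, for which the Borel sets of the product topology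
  are known to be generated by the coordinates. This is how an arbitrary open set of the solenoid, an
  uncountable union of basic ones a priori, is reached by countable operations.
\<close>

lemma solenoid_open_imp_ambient_open:
  assumes "openin (solenoid_top N) V"
  obtains W where "open W" "V = solenoid N \<inter> W"
proof -
  obtain V' where V': "openin (product_topology (\<lambda>_. top_of_set (sphere 0 1)) (Z_inv N)) V'"
    "V = V' \<inter> solenoid N"
    using assms by (auto simp: solenoid_top_def openin_subtopology)
  have "continuous_map (top_of_set (solenoid N)) (product_topology (\<lambda>_. top_of_set (sphere (0::complex) 1)) (Z_inv N)) (\<lambda>\<psi>. \<psi>)"
    unfolding continuous_map_componentwise
  proof (intro conjI ballI)
    show "(\<lambda>\<psi>. \<psi>) ` topspace (top_of_set (solenoid N)) \<subseteq> extensional (Z_inv N)"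
      by (force simp: solenoid_def PiE_def)
    fix x assume "x \<in> Z_inv N"
    then show "continuous_map (top_of_set (solenoid N)) (top_of_set (sphere 0 1)) (\<lambda>\<psi>. \<psi> x)"
      using solenoid_sphere[of _ N x]
      by (auto simp: continuous_map_in_subtopology intro!: continuous_on_subset[OF continuous_on_product_coordinates])
  qed
  from openin_continuous_map_preimage[OF this V'(1)]
  have "openin (top_of_set (solenoid N)) V" using V'(2) by (simp add: Int_def conj_commute)
  then show ?thesis using that by (auto simp: openin_open)
qed

lemma coord_continuous:
  "continuous_map (solenoid_top N) euclidean (coord N i)"
proof -
  have "continuous_map (solenoid_top N) (top_of_set (sphere 0 1)) (coord N i)"
    unfolding solenoid_top_def
    by (intro continuous_map_from_subtopology continuous_map_product_projection) simp
  then show ?thesis by (simp add: continuous_map_in_subtopology)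
qed

lemma coord_measurable_borel: "coord N i \<in> borel_measurable (solenoid_borel N)"
proof (rule borel_measurableI)
  fix W :: "complex set" assume "open W"
  with openin_continuous_map_preimage[OF coord_continuous, of W N i]
  have "openin (solenoid_top N) {\<psi> \<in> solenoid N. coord N i \<psi> \<in> W}"
    by (simp add: topspace_solenoid_top)
  then have "{\<psi> \<in> solenoid N. coord N i \<psi> \<in> W} \<in> sets (solenoid_borel N)"
    unfolding sets_solenoid_borel_opens by (intro sigma_sets.Basic) simp
  moreover have "coord N i -` W \<inter> space (solenoid_borel N) = {\<psi> \<in> solenoid N. coord N i \<psi> \<in> W}"
    by auto
  ultimately show "coord N i -` W \<inter> space (solenoid_borel N) \<in> sets (solenoid_borel N)"
    by simp
qed

lemma cylinders_Pow: "cylinders N \<subseteq> Pow (solenoid N)"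
  by (auto simp: cylinders_def cylinder_def)

lemma cylinderI: "B \<in> sets borel \<Longrightarrow> cylinder N i B \<in> cylinders N"
  by (auto simp: cylinders_def)

lemma solenoid_in_cylinders: "solenoid N \<in> cylinders N"
  using cylinderI[of UNIV N 0] by (simp add: cylinder_def)

lemma cylinder_level:
  assumes "N > 0" shows "cylinder N i B = cylinder N (i + j) ((\<lambda>z. z ^ N ^ j) -` B)"
  using coord_add_power[OF assms] by (auto simp: cylinder_def)

lemma power_vimage_borel: "B \<in> sets borel \<Longrightarrow> (\<lambda>z::complex. z ^ n) -` B \<in> sets borel"
  using measurable_sets[of "\<lambda>z::complex. z ^ n" borel borel B] by simp

lemma Int_stable_cylinders:
  assumes N: "N > 0" shows "Int_stable (cylinders N)"
proof (rule Int_stableI)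
  fix A B assume "A \<in> cylinders N" "B \<in> cylinders N"
  then obtain i A' j B' where AB: "A = cylinder N i A'" "B = cylinder N j B'"
    "A' \<in> sets borel" "B' \<in> sets borel" by (auto simp: cylinders_def)
  have "A \<inter> B = cylinder N (i + j) ((\<lambda>z. z ^ N ^ j) -` A' \<inter> (\<lambda>z. z ^ N ^ i) -` B')"
    using cylinder_level[OF N, of i A' j] cylinder_level[OF N, of j B' i]
    by (auto simp: AB add.commute cylinder_def)
  then show "A \<inter> B \<in> cylinders N" using AB power_vimage_borel by (auto intro!: cylinderI)
qed

text \<open>
  Every value \<open>\<psi> (k / N^i)\<close> is an integer power of the \<open>i\<close>-th coordinate. Hence the inclusion of the
  solenoid into \<open>rat \<Rightarrow> complex\<close> is measurable already for the \<open>\<sigma>\<close>-algebra generated by cylinders, and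
  every open set is the preimage of an ambient open set.
\<close>

lemma sets_solenoid_borel:
  assumes N: "N > 0"
  shows "sets (solenoid_borel N) = sigma_sets (solenoid N) (cylinders N)"
proof
  have "cylinder N i B \<in> sets (solenoid_borel N)" if "B \<in> sets borel" for i B
    using measurable_sets[OF coord_measurable_borel that, of N i]
    by (simp add: cylinder_def vimage_def Int_def conj_commute)
  then have "cylinders N \<subseteq> sets (solenoid_borel N)" by (auto simp: cylinders_def)
  then show "sigma_sets (solenoid N) (cylinders N) \<subseteq> sets (solenoid_borel N)"
    using sets.sigma_sets_subset[of "cylinders N" "solenoid_borel N"] by simp
next
  define M where "M = sigma (solenoid N) (cylinders N)"
  have space_M: "space M = solenoid N" and sets_M: "sets M = sigma_sets (solenoid N) (cylinders N)"
    unfolding M_def using cylinders_Pow by (auto simp: space_measure_of sets_measure_of)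
  have coord_M: "coord N i \<in> borel_measurable M" for i
  proof (rule measurableI)
    fix B :: "complex set" assume "B \<in> sets borel"
    then have "cylinder N i B \<in> sets M" unfolding sets_M by (intro sigma_sets.Basic cylinderI)
    then show "coord N i -` B \<inter> space M \<in> sets M"
      by (simp add: cylinder_def space_M vimage_def Int_def conj_commute)
  qed simp
  have eval_M: "(\<lambda>\<psi>. \<psi> x) \<in> borel_measurable M" for x
  proof (cases "x \<in> Z_inv N")
    case True
    then obtain k i where x: "x = of_int k / of_nat N ^ i" by (auto simp: Z_inv_def)
    have "(\<lambda>\<psi>. coord N i \<psi> powi k) \<in> borel_measurable M"
      using coord_M[of i] unfolding power_int_def by (cases "k \<ge> 0") auto
    moreover have "coord N i \<psi> powi k = \<psi> x" if "\<psi> \<in> space M" for \<psi>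
      using solenoid_of_int_mult[OF N, of \<psi> "1 / of_nat N ^ i" k] that by (simp add: x space_M)
    ultimately show ?thesis by (subst measurable_cong[of M, symmetric]) auto
  next
    case False
    then have "(\<lambda>\<psi>. \<psi> x) \<in> borel_measurable M \<longleftrightarrow> (\<lambda>_. undefined :: complex) \<in> borel_measurable M"
      by (intro measurable_cong) (simp add: space_M solenoid_outside)
    then show ?thesis by simp
  qed
  have id_M: "(\<lambda>\<psi>. \<psi>) \<in> borel_measurable M"
    using eval_M by (intro measurable_coordinatewise_then_product) auto
  have "V \<in> sets M" if V: "openin (solenoid_top N) V" for V
  proof -
    obtain W where W: "open W" "V = solenoid N \<inter> W" using solenoid_open_imp_ambient_open[OF V] .
    have "(\<lambda>\<psi>. \<psi>) -` W \<inter> space M \<in> sets M" by (rule measurable_sets[OF id_M]) (use W in auto)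
    then show ?thesis using W by (simp add: space_M Int_commute)
  qed
  then have "{V. openin (solenoid_top N) V} \<subseteq> sets M" by auto
  then have "sigma_sets (solenoid N) {V. openin (solenoid_top N) V} \<subseteq> sets M"
    using sets.sigma_sets_subset[of _ M] space_M by auto
  then show "sets (solenoid_borel N) \<subseteq> sigma_sets (solenoid N) (cylinders N)"
    by (simp add: sets_M sets_solenoid_borel_opens)
qed

lemma measurable_into_solenoid:
  assumes N: "N > 0" and f: "\<And>x. x \<in> space M \<Longrightarrow> f x \<in> solenoid N"
    and coord: "\<And>i. (\<lambda>x. coord N i (f x)) \<in> borel_measurable M"
  shows "f \<in> M \<rightarrow>\<^sub>M solenoid_borel N"
proof (rule measurable_sigma_sets[OF sets_solenoid_borel[OF N] cylinders_Pow])
  show "f \<in> space M \<rightarrow> solenoid N" using f by auto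
  fix A assume "A \<in> cylinders N"
  then obtain i B where A: "A = cylinder N i B" and B: "B \<in> sets borel" by (auto simp: cylinders_def)
  have "f -` A \<inter> space M = (\<lambda>x. coord N i (f x)) -` B \<inter> space M"
    using f by (auto simp: A cylinder_def)
  then show "f -` A \<inter> space M \<in> sets M" using measurable_sets[OF coord B] by simp
qed

lemma coord_shift_power:
  assumes "N > 0" "\<psi> \<in> solenoid N"
  shows "coord N i (shift N \<psi>) = coord N i \<psi> ^ N"
  using coord_add_power[OF assms(1) shift_solenoid[OF assms(2,1)], of i 1]
    coord_shift[OF assms(1), where i = i and \<psi> = \<psi>] by simp

lemma shift_measurable:
  assumes N: "N > 0"
  shows "shift N \<in> solenoid_borel N \<rightarrow>\<^sub>M solenoid_borel N"
proof (rule measurable_into_solenoid[OF N])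
  fix i
  have "(\<lambda>\<psi>. coord N i \<psi> ^ N) \<in> borel_measurable (solenoid_borel N)"
    by (rule borel_measurable_power[OF coord_measurable_borel])
  then show "(\<lambda>\<psi>. coord N i (shift N \<psi>)) \<in> borel_measurable (solenoid_borel N)"
    by (subst measurable_cong[OF coord_shift_power[OF N]]) simp_all
qed (auto intro: shift_solenoid N)

lemma unshift_measurable: "N > 0 \<Longrightarrow> unshift N \<in> solenoid_borel N \<rightarrow>\<^sub>M solenoid_borel N"
  by (rule measurable_into_solenoid)
    (simp_all only: coord_unshift coord_measurable_borel space_solenoid_borel unshift_solenoid)

section \<open>The measure on the solenoid and the weighted shift\<close>

locale solenoid_measure_setup =
  fixes N :: nat and m0 :: "complex \<Rightarrow> complex" and h :: "complex \<Rightarrow> real"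
    and \<nu> :: "(rat \<Rightarrow> complex) measure"
  assumes N: "N > 0" and m0: "m0 \<in> Linf haar_circle"
    and h: "integrable haar_circle h" and h_nonneg: "AE z in haar_circle. 0 \<le> h z"
    and \<nu>: "solenoid_measure N m0 h \<nu>"
begin

lemma finite_\<nu>: "finite_measure \<nu>" and sets_\<nu> [measurable_cong]: "sets \<nu> = sets (solenoid_borel N)"
  using \<nu> by (auto simp: solenoid_measure_def)

lemma space_\<nu> [simp]: "space \<nu> = solenoid N"
  using sets_eq_imp_space_eq[OF sets_\<nu>] by simp

lemma m0_measurable [measurable]: "m0 \<in> borel_measurable haar_circle"
  using m0 by (simp add: Linf_def)

lemma coord_measurable [measurable]: "coord N i \<in> \<nu> \<rightarrow>\<^sub>M haar_circle"
proof -
  have "coord N i \<in> \<nu> \<rightarrow>\<^sub>M restrict_space borel (sphere 0 1)"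
    by (rule measurable_restrict_space2)
      (auto simp: coord_sphere measurable_cong_sets[OF sets_\<nu> refl] coord_measurable_borel)
  then show ?thesis by (simp add: measurable_cong_sets[OF refl sets_haar_circle])
qed

lemma eval_one_measurable [measurable]: "(\<lambda>\<psi>. \<psi> 1) \<in> \<nu> \<rightarrow>\<^sub>M haar_circle"
  using coord_measurable[of 0] by simp

lemma shift_measurable_\<nu> [measurable]: "shift N \<in> \<nu> \<rightarrow>\<^sub>M \<nu>"
  using shift_measurable[OF N] by (simp add: measurable_cong_sets[OF sets_\<nu> sets_\<nu>])

lemma unshift_measurable_\<nu> [measurable]: "unshift N \<in> \<nu> \<rightarrow>\<^sub>M \<nu>"
  using unshift_measurable[OF N] by (simp add: measurable_cong_sets[OF sets_\<nu> sets_\<nu>])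

text \<open>
  Both measures have the same integrals of continuous functions, by the property that characterizes
  \<open>\<nu>\<close> and the formula for the iterates of the transfer operator.
\<close>

lemma distr_coord:
  "distr \<nu> haar_circle (coord N i) = density haar_circle (\<lambda>z. ennreal (cascade_weight N m0 i z * h z))"
proof (rule finite_measures_on_circle_eqI)
  note [measurable] = cascade_weight_measurable[OF m0_measurable] borel_measurable_integrable[OF h]
  let ?w = "\<lambda>z. cascade_weight N m0 i z * h z"
  have w_nonneg: "AE z in haar_circle. 0 \<le> ?w z"
    using h_nonneg by eventually_elim (simp add: cascade_weight_nonneg)
  have "integrable haar_circle (\<lambda>z. complex_of_real (?w z))"
    using integrable_cascade_weight_mult[OF N m0, of "\<lambda>z. complex_of_real (h z)" i] h by simp
  then have w: "integrable haar_circle ?w" by (simp only: complex_of_real_integrable_eq)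
  show "finite_measure (distr \<nu> haar_circle (coord N i))"
    using finite_measure.finite_measure_distr[OF finite_\<nu> coord_measurable] .
  show "finite_measure (density haar_circle (\<lambda>z. ennreal (?w z)))"
  proof (rule finite_measureI)
    have "(\<integral>\<^sup>+z. ennreal (?w z) \<partial>haar_circle) = ennreal (\<integral>z. ?w z \<partial>haar_circle)"
      by (rule nn_integral_eq_integral[OF w w_nonneg])
    moreover have "emeasure (density haar_circle (\<lambda>z. ennreal (?w z))) (space haar_circle)
        = (\<integral>\<^sup>+z. ennreal (?w z) * indicator (space haar_circle) z \<partial>haar_circle)"
      by (rule emeasure_density) auto
    moreover have "\<dots> = (\<integral>\<^sup>+z. ennreal (?w z) \<partial>haar_circle)"
      by (rule nn_integral_cong) simp
    ultimately show "emeasure (density haar_circle (\<lambda>z. ennreal (?w z)))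
        (space (density haar_circle (\<lambda>z. ennreal (?w z)))) \<noteq> \<infinity>" by simp
  qed
  fix f :: "complex \<Rightarrow> complex" assume f: "continuous_on (sphere 0 1) f"
  have fm [measurable]: "f \<in> borel_measurable haar_circle"
    using borel_measurable_continuous_on_restrict[OF f] by (simp add: measurable_cong_sets[OF sets_haar_circle refl])
  obtain K where K: "\<forall>z\<in>sphere 0 1. cmod (f z) \<le> K"
    using compact_imp_bounded[OF compact_continuous_image[OF f compact_sphere]] by (auto simp: bounded_iff)
  have fh: "integrable haar_circle (\<lambda>z. f z * of_real (h z))"
  proof (rule Bochner_Integration.integrable_bound)
    show "integrable haar_circle (\<lambda>z. K * h z)" using h by simp
    show "AE z in haar_circle. norm (f z * of_real (h z)) \<le> norm (K * h z)"
    proof (rule AE_I2)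
      fix z assume "z \<in> space haar_circle"
      then have "cmod (f z) \<le> K" using K by simp
      moreover from this have "0 \<le> K" using norm_ge_zero order_trans by blast
      ultimately show "norm (f z * of_real (h z)) \<le> norm (K * h z)"
        by (auto simp: norm_mult abs_mult intro!: mult_right_mono)
    qed
  qed measurable
  have "(\<integral>z. f z \<partial>distr \<nu> haar_circle (coord N i)) = (\<integral>\<psi>. lift N i f \<psi> \<partial>\<nu>)"
    unfolding lift_def by (rule integral_distr[OF coord_measurable fm])
  also have "\<dots> = (\<integral>z. (transfer_op N m0 ^^ i) (\<lambda>w. f w * of_real (h w)) z \<partial>haar_circle)"
    using \<nu> f by (simp add: solenoid_measure_def)
  also have "\<dots> = (\<integral>z. of_real (cascade_weight N m0 i z) * (f z * of_real (h z)) \<partial>haar_circle)"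
    by (rule transfer_op_iterates[OF N m0 fh])
  also have "\<dots> = (\<integral>z. ?w z *\<^sub>R f z \<partial>haar_circle)"
    by (simp add: scaleR_conv_of_real mult_ac)
  also have "\<dots> = (\<integral>z. f z \<partial>density haar_circle (\<lambda>z. ennreal (?w z)))"
    using w_nonneg by (subst integral_density) auto
  finally show "(\<integral>z. f z \<partial>distr \<nu> haar_circle (coord N i)) = (\<integral>z. f z \<partial>density haar_circle (\<lambda>z. ennreal (?w z)))" .
qed simp_all

lemma distr_eval_one: "distr \<nu> haar_circle (\<lambda>\<psi>. \<psi> 1) = weighted_circle h"
  using distr_coord[of 0] by (simp add: weighted_circle_def)

text \<open>
  The preimage under the shift of a cylinder of level \<open>i + 1\<close> is the cylinder of level \<open>i\<close> with the
  same base, and on it \<open>\<psi> 1\<close> is the power \<open>N^i\<close> of the \<open>i\<close>-th coordinate. The weight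
  \<open>|m\<^sub>0(\<psi> 1)|\<^sup>2\<close> then supplies exactly the factor by which the densities of the two levels differ.
\<close>

lemma distr_shift: "distr (density \<nu> (\<lambda>\<psi>. ennreal ((cmod (m0 (\<psi> 1)))\<^sup>2))) \<nu> (shift N) = \<nu>" (is "?Q = \<nu>")
proof (rule measure_eqI_generator_eq[symmetric, where \<Omega> = "solenoid N" and E = "cylinders N" and A = "\<lambda>_. solenoid N"])
  note [measurable] = cascade_weight_measurable[OF m0_measurable] borel_measurable_integrable[OF h]
  have level: "emeasure ?Q (cylinder N (Suc i) B) = emeasure \<nu> (cylinder N (Suc i) B)" if B: "B \<in> sets borel" for i B
  proof -
    let ?B = "B \<inter> sphere 0 1"
    have B' [measurable]: "?B \<in> sets haar_circle"
      using B by (auto simp: sets_haar_circle sets_restrict_space)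
    have cyl: "coord N j -` ?B \<inter> space \<nu> = cylinder N j B" for j
      by (auto simp: cylinder_def coord_sphere)
    have cyl_sets: "cylinder N j B \<in> sets \<nu>" for j
      using measurable_sets[OF coord_measurable B', of j] cyl by simp
    have pre: "shift N -` cylinder N (Suc i) B \<inter> solenoid N = cylinder N i B"
      using coord_shift[OF N, where i = i] shift_solenoid N by (auto simp: cylinder_def)
    have "emeasure ?Q (cylinder N (Suc i) B)
        = emeasure (density \<nu> (\<lambda>\<psi>. ennreal ((cmod (m0 (\<psi> 1)))\<^sup>2))) (cylinder N i B)"
      using cyl_sets pre by (subst emeasure_distr) auto
    also have "\<dots> = (\<integral>\<^sup>+\<psi>. ennreal ((cmod (m0 (\<psi> 1)))\<^sup>2) * indicator (cylinder N i B) \<psi> \<partial>\<nu>)"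
      using cyl_sets by (subst emeasure_density) auto
    also have "\<dots> = (\<integral>\<^sup>+\<psi>. ennreal ((cmod (m0 (coord N i \<psi> ^ N ^ i)))\<^sup>2) * indicator ?B (coord N i \<psi>) \<partial>\<nu>)"
      using coord_add_power[OF N, where i = 0 and j = i]
      by (intro nn_integral_cong) (auto simp: cylinder_def indicator_def coord_sphere)
    also have "\<dots> = (\<integral>\<^sup>+z. ennreal ((cmod (m0 (z ^ N ^ i)))\<^sup>2) * indicator ?B z \<partial>distr \<nu> haar_circle (coord N i))"
      by (subst nn_integral_distr) auto
    also have "\<dots> = (\<integral>\<^sup>+z. ennreal (cascade_weight N m0 i z * h z) * (ennreal ((cmod (m0 (z ^ N ^ i)))\<^sup>2) * indicator ?B z) \<partial>haar_circle)"
      unfolding distr_coord by (subst nn_integral_density) auto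
    also have "\<dots> = (\<integral>\<^sup>+z. ennreal (cascade_weight N m0 (Suc i) z * h z) * indicator ?B z \<partial>haar_circle)"
    proof (rule nn_integral_cong_AE)
      show "AE z in haar_circle. ennreal (cascade_weight N m0 i z * h z) * (ennreal ((cmod (m0 (z ^ N ^ i)))\<^sup>2) * indicator ?B z)
          = ennreal (cascade_weight N m0 (Suc i) z * h z) * indicator ?B z"
        using h_nonneg
        by eventually_elim
          (simp add: cascade_weight_Suc ennreal_mult'[symmetric] ennreal_mult[symmetric] cascade_weight_nonneg mult_ac indicator_def)
    qed
    also have "\<dots> = emeasure (distr \<nu> haar_circle (coord N (Suc i))) ?B"
      unfolding distr_coord by (subst emeasure_density) auto
    also have "\<dots> = emeasure \<nu> (cylinder N (Suc i) B)"
      using emeasure_distr[OF coord_measurable B', of "Suc i"] by (simp only: cyl)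
    finally show ?thesis .
  qed
  fix X assume "X \<in> cylinders N"
  then obtain i B where X: "X = cylinder N i B" and B: "B \<in> sets borel" by (auto simp: cylinders_def)
  have "X = cylinder N (Suc i) ((\<lambda>z. z ^ N) -` B)" using cylinder_level[OF N, of i B 1] X by simp
  then show "emeasure \<nu> X = emeasure ?Q X" using level[OF power_vimage_borel[OF B]] by simp
qed (use N finite_measure.emeasure_finite[OF finite_\<nu>] in
    \<open>auto simp: sets_\<nu> sets_solenoid_borel Int_stable_cylinders solenoid_in_cylinders dest: subsetD[OF cylinders_Pow]\<close>)

lemma
  fixes G :: "(rat \<Rightarrow> complex) \<Rightarrow> real"
  assumes [measurable]: "G \<in> borel_measurable \<nu>"
  shows integrable_shift: "integrable \<nu> (\<lambda>\<psi>. (cmod (m0 (\<psi> 1)))\<^sup>2 * G (shift N \<psi>)) \<longleftrightarrow> integrable \<nu> G"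
    and integral_shift: "(\<integral>\<psi>. (cmod (m0 (\<psi> 1)))\<^sup>2 * G (shift N \<psi>) \<partial>\<nu>) = (\<integral>\<psi>. G \<psi> \<partial>\<nu>)"
proof -
  let ?D = "density \<nu> (\<lambda>\<psi>. ennreal ((cmod (m0 (\<psi> 1)))\<^sup>2))"
  have "integrable \<nu> G \<longleftrightarrow> integrable (distr ?D \<nu> (shift N)) G" by (simp only: distr_shift)
  also have "\<dots> \<longleftrightarrow> integrable \<nu> (\<lambda>\<psi>. (cmod (m0 (\<psi> 1)))\<^sup>2 * G (shift N \<psi>))"
    by (subst integrable_distr_eq) (auto simp: integrable_density)
  finally show "integrable \<nu> (\<lambda>\<psi>. (cmod (m0 (\<psi> 1)))\<^sup>2 * G (shift N \<psi>)) \<longleftrightarrow> integrable \<nu> G" by simp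
  have "(\<integral>\<psi>. G \<psi> \<partial>\<nu>) = (\<integral>\<psi>. G \<psi> \<partial>distr ?D \<nu> (shift N))" by (simp only: distr_shift)
  also have "\<dots> = (\<integral>\<psi>. (cmod (m0 (\<psi> 1)))\<^sup>2 * G (shift N \<psi>) \<partial>\<nu>)"
    by (subst integral_distr) (auto simp: integral_density)
  finally show "(\<integral>\<psi>. (cmod (m0 (\<psi> 1)))\<^sup>2 * G (shift N \<psi>) \<partial>\<nu>) = (\<integral>\<psi>. G \<psi> \<partial>\<nu>)" by simp
qed

text \<open>
  The explicit model of \<open>\<pi>\<^sub>\<nu>(U)\<close>.
\<close>

definition shift_op :: "((rat \<Rightarrow> complex) \<Rightarrow> complex) \<Rightarrow> (rat \<Rightarrow> complex) \<Rightarrow> complex" where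
  "shift_op F \<psi> = m0 (\<psi> 1) * F (shift N \<psi>)"

lemma shift_op_measurable: "F \<in> borel_measurable \<nu> \<Longrightarrow> shift_op F \<in> borel_measurable \<nu>"
  unfolding shift_op_def[abs_def]
  by (intro borel_measurable_times measurable_compose[OF eval_one_measurable m0_measurable]
      measurable_compose[OF shift_measurable_\<nu>])

lemma shift_op_L2_iff:
  assumes [measurable]: "F \<in> borel_measurable \<nu>" shows "shift_op F \<in> L2 \<nu> \<longleftrightarrow> F \<in> L2 \<nu>"
  using integrable_shift[of "\<lambda>\<psi>. (cmod (F \<psi>))\<^sup>2"] shift_op_measurable[OF assms] assms
  by (simp add: L2_def shift_op_def norm_mult power_mult_distrib)

lemma shift_op_isometry: "L2_isometry \<nu> \<nu> shift_op"
  unfolding L2_isometry_def L2_linear_def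
proof (intro conjI ballI impI allI)
  fix F assume F: "F \<in> L2 \<nu>"
  show "shift_op F \<in> L2 \<nu>" using F shift_op_L2_iff L2_measurable by blast
  show "L2_norm \<nu> (shift_op F) = L2_norm \<nu> F"
    using integral_shift[of "\<lambda>\<psi>. (cmod (F \<psi>))\<^sup>2"] L2_measurable[OF F]
    by (simp add: L2_norm_def shift_op_def norm_mult power_mult_distrib)
  fix G assume G: "G \<in> L2 \<nu>"
  show "AE \<psi> in \<nu>. shift_op (\<lambda>x. a * F x + b * G x) \<psi> = a * shift_op F \<psi> + b * shift_op G \<psi>" for a b
    by (simp add: shift_op_def algebra_simps)
  assume "AE \<psi> in \<nu>. F \<psi> = G \<psi>"
  then have "AE \<psi> in distr (density \<nu> (\<lambda>\<psi>. ennreal ((cmod (m0 (\<psi> 1)))\<^sup>2))) \<nu> (shift N). F \<psi> = G \<psi>"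
    by (simp only: distr_shift)
  then have "AE \<psi> in density \<nu> (\<lambda>\<psi>. ennreal ((cmod (m0 (\<psi> 1)))\<^sup>2)). F (shift N \<psi>) = G (shift N \<psi>)"
    by (rule AE_distrD[rotated]) measurable
  then have "AE \<psi> in \<nu>. 0 < ennreal ((cmod (m0 (\<psi> 1)))\<^sup>2) \<longrightarrow> F (shift N \<psi>) = G (shift N \<psi>)"
    by (subst (asm) AE_density) measurable
  then show "AE \<psi> in \<nu>. shift_op F \<psi> = shift_op G \<psi>"
    by eventually_elim (auto simp: shift_op_def)
qed

text \<open>
  The preimage of \<open>g\<close> is found by dividing by the weight and shifting back.
  Division is legitimate almost everywhere: \<open>\<psi> 1\<close> has distribution \<open>h d\<mu>\<close>, which does not charge the zeros of
  \<open>m\<^sub>0\<close>.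
\<close>

lemma shift_op_unitary:
  assumes "nonsingular m0" shows "L2_unitary \<nu> shift_op"
  unfolding L2_unitary_def
proof (intro conjI ballI shift_op_isometry)
  note [measurable] = borel_measurable_integrable[OF h]
  fix g assume g: "g \<in> L2 \<nu>"
  note [measurable] = L2_measurable[OF g]
  define F where "F \<psi> = g (unshift N \<psi>) / m0 (unshift N \<psi> 1)" for \<psi>
  have Fm: "F \<in> borel_measurable \<nu>" unfolding F_def by measurable
  have "AE z in weighted_circle h. m0 z \<noteq> 0"
    using assms unfolding weighted_circle_def nonsingular_def
    by (subst AE_density) (auto elim: eventually_mono)
  then have "AE z in distr \<nu> haar_circle (\<lambda>\<psi>. \<psi> 1). m0 z \<noteq> 0" by (simp only: distr_eval_one)
  then have "AE \<psi> in \<nu>. m0 (\<psi> 1) \<noteq> 0" by (rule AE_distrD[rotated]) measurable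
  then have eq: "AE \<psi> in \<nu>. shift_op F \<psi> = g \<psi>"
    using AE_space by eventually_elim (simp add: shift_op_def F_def unshift_shift N)
  have "integrable \<nu> (\<lambda>\<psi>. (cmod (shift_op F \<psi>))\<^sup>2) \<longleftrightarrow> integrable \<nu> (\<lambda>\<psi>. (cmod (g \<psi>))\<^sup>2)"
    using eq shift_op_measurable[OF Fm] by (intro integrable_cong_AE) (auto elim: eventually_mono)
  then have "shift_op F \<in> L2 \<nu>" using g shift_op_measurable[OF Fm] by (simp add: L2_def)
  then show "\<exists>f\<in>L2 \<nu>. AE \<psi> in \<nu>. shift_op f \<psi> = g \<psi>" using eq shift_op_L2_iff[OF Fm] by blast
qed

lemma shift_op_lift:
  "\<psi> \<in> solenoid N \<Longrightarrow> shift_op (lift N (Suc i) f) \<psi> = lift N i f \<psi> * lift N 0 m0 \<psi>"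
  using coord_shift[OF N, where i = i and \<psi> = \<psi>] by (simp add: shift_op_def lift_def)

lemma shift_op_pi_U: "pi_U N m0 \<nu> shift_op"
  unfolding pi_U_def
  using L2_isometry_imp_bounded[OF shift_op_isometry] shift_op_lift by auto

text \<open>
  The characterizing property covers lifts of level at least one. A cylinder of level \<open>i\<close> over \<open>B\<close> is
  the cylinder of level \<open>i + 1\<close> over the preimage of \<open>B\<close> under \<open>z \<mapsto> z^N\<close>, so its indicator is such a
  lift.
\<close>

lemma pi_U_unique:
  assumes pi: "pi_U N m0 \<nu> T" and F: "F \<in> L2 \<nu>"
  shows "AE \<psi> in \<nu>. T F \<psi> = shift_op F \<psi>"
proof -
  have Tb: "L2_bounded_operator \<nu> \<nu> T" using pi by (simp add: pi_U_def)
  interpret L2_operator_pair \<nu> \<nu> shift_op T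
    by unfold_locales (rule L2_isometry_imp_bounded[OF shift_op_isometry], rule Tb)
  interpret finite_measure \<nu> by (rule finite_\<nu>)
  have "indicator A \<in> agree" if A_cyl: "A \<in> cylinders N" for A
  proof -
    obtain i B where A: "A = cylinder N i B" and B: "B \<in> sets borel" using A_cyl by (auto simp: cylinders_def)
    \<comment> \<open>The base of the same cylinder one level higher.\<close>
    define f where "f = (indicator ((\<lambda>z. z ^ N) -` B) :: complex \<Rightarrow> complex)"
    have fm: "f \<in> borel_measurable haar_circle"
      unfolding f_def measurable_cong_sets[OF sets_haar_circle refl]
      by (intro measurable_restrict_space1 borel_measurable_indicator power_vimage_borel B)
    have f: "f \<in> Linf haar_circle" using fm by (auto simp: Linf_def f_def indicator_def intro!: exI[of _ 1])
    \<comment> \<open>The two functions differ off the solenoid, where the lift sees default values.\<close>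
    have A_lift: "indicator A \<psi> = lift N (Suc i) f \<psi>" if "\<psi> \<in> solenoid N" for \<psi>
      using cylinder_level[OF N, of i B 1] that
      by (auto simp: A f_def lift_def cylinder_def indicator_def simp del: power_Suc)
    have "A \<in> sets \<nu>" using A_cyl by (auto simp: sets_\<nu> sets_solenoid_borel N)
    then have ind: "indicator A \<in> L2 \<nu>" by (rule L2_indicator)
    have "lift N (Suc i) f \<in> L2 \<nu>"
    proof (rule L2_dominated[OF ind, where C = 1])
      show "lift N (Suc i) f \<in> borel_measurable \<nu>"
        unfolding lift_def[abs_def] by (rule measurable_compose[OF coord_measurable fm])
    qed (simp add: A_lift)
    moreover have "AE \<psi> in \<nu>. indicator A \<psi> = lift N (Suc i) f \<psi>" by (rule AE_I2) (simp add: A_lift)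
    ultimately have "AE \<psi> in \<nu>. T (indicator A) \<psi> = T (lift N (Suc i) f) \<psi>"
      "AE \<psi> in \<nu>. shift_op (indicator A) \<psi> = shift_op (lift N (Suc i) f) \<psi>"
      using Tb shift_op_isometry ind unfolding L2_bounded_operator_def L2_isometry_def L2_linear_def by blast+
    moreover have "AE \<psi> in \<nu>. T (lift N (Suc i) f) \<psi> = lift N i f \<psi> * lift N 0 m0 \<psi>"
      using pi f unfolding pi_U_def by blast
    ultimately have "AE \<psi> in \<nu>. T (indicator A) \<psi> = shift_op (indicator A) \<psi>"
      using AE_space by eventually_elim (simp add: shift_op_lift)
    then show ?thesis using ind by (simp add: agree_def)
  qed
  then have "L2 \<nu> \<subseteq> agree"
    by (intro L2_subset_agree[OF finite_\<nu>, of "cylinders N"])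
      (use N cylinders_Pow in \<open>simp_all add: Int_stable_cylinders sets_\<nu> sets_solenoid_borel solenoid_in_cylinders\<close>)
  then show ?thesis using F by (auto simp: agree_def)
qed

lemma pi_U_unitary:
  assumes "nonsingular m0" and T: "pi_U N m0 \<nu> T" shows "L2_unitary \<nu> T"
  unfolding L2_unitary_def L2_isometry_def
proof (intro conjI ballI)
  show lin: "L2_linear \<nu> \<nu> T" using T by (simp add: pi_U_def L2_bounded_operator_def)
  fix F assume F: "F \<in> L2 \<nu>"
  have "L2_norm \<nu> (T F) = L2_norm \<nu> (shift_op F)"
    using pi_U_unique[OF T F] lin F L2_measurable shift_op_isometry
    by (intro L2_norm_cong_AE) (auto simp: L2_linear_def L2_isometry_def)
  then show "L2_norm \<nu> (T F) = L2_norm \<nu> F" using shift_op_isometry F by (simp add: L2_isometry_def)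
next
  fix g assume "g \<in> L2 \<nu>"
  then obtain F where F: "F \<in> L2 \<nu>" "AE \<psi> in \<nu>. shift_op F \<psi> = g \<psi>"
    using shift_op_unitary[OF assms(1)] by (auto simp: L2_unitary_def)
  have "AE \<psi> in \<nu>. T F \<psi> = g \<psi>" using pi_U_unique[OF T F(1)] F(2) by eventually_elim simp
  then show "\<exists>f\<in>L2 \<nu>. AE \<psi> in \<nu>. T f \<psi> = g \<psi>" using F(1) by blast
qed

lemma weighted_circle_measurable [simp]:
  "borel_measurable (weighted_circle h) = borel_measurable haar_circle"
  by (intro measurable_cong_sets) (simp_all add: weighted_circle_def)

lemma lift_measurable: "\<xi> \<in> borel_measurable haar_circle \<Longrightarrow> lift N 0 \<xi> \<in> borel_measurable \<nu>"
  unfolding lift_def[abs_def] by simp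

lemma lift_L2_iff:
  assumes [measurable]: "\<xi> \<in> borel_measurable haar_circle"
  shows "lift N 0 \<xi> \<in> L2 \<nu> \<longleftrightarrow> \<xi> \<in> L2 (weighted_circle h)"
proof -
  have "integrable (weighted_circle h) (\<lambda>z. (cmod (\<xi> z))\<^sup>2) \<longleftrightarrow> integrable \<nu> (\<lambda>\<psi>. (cmod (\<xi> (\<psi> 1)))\<^sup>2)"
    unfolding distr_eval_one[symmetric] by (rule integrable_distr_eq[OF eval_one_measurable]) measurable
  then show ?thesis using lift_measurable[OF assms] assms by (simp add: L2_def lift_def)
qed

lemma lift_norm:
  assumes [measurable]: "\<xi> \<in> borel_measurable haar_circle"
  shows "L2_norm \<nu> (lift N 0 \<xi>) = L2_norm (weighted_circle h) \<xi>"
proof -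
  have "(\<integral>z. (cmod (\<xi> z))\<^sup>2 \<partial>weighted_circle h) = (\<integral>\<psi>. (cmod (\<xi> (\<psi> 1)))\<^sup>2 \<partial>\<nu>)"
    unfolding distr_eval_one[symmetric] by (rule integral_distr[OF eval_one_measurable]) measurable
  then show ?thesis by (simp add: L2_norm_def lift_def)
qed

lemma lift_AE_iff:
  assumes [measurable]: "\<xi> \<in> borel_measurable haar_circle" "\<eta> \<in> borel_measurable haar_circle"
  shows "(AE \<psi> in \<nu>. lift N 0 \<xi> \<psi> = lift N 0 \<eta> \<psi>) \<longleftrightarrow> (AE z in weighted_circle h. \<xi> z = \<eta> z)"
  unfolding distr_eval_one[symmetric] 
  by (subst AE_distr_iff[OF eval_one_measurable]) (measurable, simp add: lift_def)

lemma lift_isometry: "L2_isometry (weighted_circle h) \<nu> (lift N 0)"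
proof -
  have "\<xi> \<in> borel_measurable haar_circle" if "\<xi> \<in> L2 (weighted_circle h)" for \<xi>
    using L2_measurable[OF that] by simp
  then show ?thesis
    unfolding L2_isometry_def L2_linear_def
    by (auto simp: lift_L2_iff lift_norm lift_AE_iff) (simp add: lift_def)
qed

lemma S0_measurable:
  assumes [measurable]: "\<xi> \<in> borel_measurable haar_circle" shows "S0 N m0 \<xi> \<in> borel_measurable haar_circle"
  unfolding S0_def[abs_def] by measurable

lemma shift_op_intertwines:
  "\<psi> \<in> solenoid N \<Longrightarrow> shift_op (lift N 0 \<xi>) \<psi> = lift N 0 (S0 N m0 \<xi>) \<psi>"
  using coord_shift_power[OF N, where i = 0] by (simp add: shift_op_def lift_def S0_def)

text \<open>
  Everything is pulled back along the embedding, under which \<open>S\<^sub>0\<close> becomes the restriction of the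
  weighted shift, an isometry.
\<close>

lemma S0_isometry: "L2_isometry (weighted_circle h) (weighted_circle h) (S0 N m0)"
  unfolding L2_isometry_def L2_linear_def
proof (intro conjI ballI impI allI)
  fix \<xi> assume \<xi>: "\<xi> \<in> L2 (weighted_circle h)"
  note meas = L2_measurable[OF \<xi>, simplified]
  have J\<xi>: "lift N 0 \<xi> \<in> L2 \<nu>" using \<xi> meas by (simp add: lift_L2_iff)
  have AE_eq: "AE \<psi> in \<nu>. shift_op (lift N 0 \<xi>) \<psi> = lift N 0 (S0 N m0 \<xi>) \<psi>" for \<xi>
    by (rule AE_I2) (simp add: shift_op_intertwines)
  have "shift_op (lift N 0 \<xi>) \<in> L2 \<nu>" using J\<xi> shift_op_isometry by (simp add: L2_isometry_def L2_linear_def)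
  then have "lift N 0 (S0 N m0 \<xi>) \<in> L2 \<nu>"
    by (rule L2_dominated[where C = 1])
      (simp_all add: lift_measurable S0_measurable meas shift_op_intertwines)
  then show "S0 N m0 \<xi> \<in> L2 (weighted_circle h)" using meas by (simp add: lift_L2_iff S0_measurable)
  have "L2_norm (weighted_circle h) (S0 N m0 \<xi>) = L2_norm \<nu> (lift N 0 (S0 N m0 \<xi>))"
    using meas by (simp add: lift_norm S0_measurable)
  also have "\<dots> = L2_norm \<nu> (shift_op (lift N 0 \<xi>))"
    using AE_eq[of \<xi>] meas
    by (intro L2_norm_cong_AE) (auto simp: lift_measurable S0_measurable shift_op_measurable elim: eventually_mono)
  also have "\<dots> = L2_norm (weighted_circle h) \<xi>"
    using shift_op_isometry J\<xi> meas by (simp add: L2_isometry_def lift_norm)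
  finally show "L2_norm (weighted_circle h) (S0 N m0 \<xi>) = L2_norm (weighted_circle h) \<xi>" .
  fix \<eta> assume \<eta>: "\<eta> \<in> L2 (weighted_circle h)"
  note meas' = L2_measurable[OF \<eta>, simplified]
  have J\<eta>: "lift N 0 \<eta> \<in> L2 \<nu>" using \<eta> meas' by (simp add: lift_L2_iff)
  show "AE z in weighted_circle h. S0 N m0 (\<lambda>x. a * \<xi> x + b * \<eta> x) z = a * S0 N m0 \<xi> z + b * S0 N m0 \<eta> z" for a b
    by (simp add: S0_def algebra_simps)
  assume "AE z in weighted_circle h. \<xi> z = \<eta> z"
  then have "AE \<psi> in \<nu>. lift N 0 \<xi> \<psi> = lift N 0 \<eta> \<psi>" using meas meas' by (simp add: lift_AE_iff)
  then have "AE \<psi> in \<nu>. shift_op (lift N 0 \<xi>) \<psi> = shift_op (lift N 0 \<eta>) \<psi>"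
    using shift_op_isometry J\<xi> J\<eta> by (simp add: L2_isometry_def L2_linear_def)
  then have "AE \<psi> in \<nu>. lift N 0 (S0 N m0 \<xi>) \<psi> = lift N 0 (S0 N m0 \<eta>) \<psi>"
    using AE_eq[of \<xi>] AE_eq[of \<eta>] by eventually_elim simp
  then show "AE z in weighted_circle h. S0 N m0 \<xi> z = S0 N m0 \<eta> z"
    using meas meas' by (simp add: lift_AE_iff S0_measurable)
qed

lemma pi_U_extension:
  assumes T: "pi_U N m0 \<nu> T"
  shows "L2_extension (weighted_circle h) \<nu> (lift N 0) (S0 N m0) T"
  unfolding L2_extension_def
proof
  fix \<xi> assume "\<xi> \<in> L2 (weighted_circle h)"
  then have "lift N 0 \<xi> \<in> L2 \<nu>" using lift_isometry by (simp add: L2_isometry_def L2_linear_def)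
  from pi_U_unique[OF T this] AE_space
  show "AE \<psi> in \<nu>. T (lift N 0 \<xi>) \<psi> = lift N 0 (S0 N m0 \<xi>) \<psi>"
    by eventually_elim (simp add: shift_op_intertwines)
qed

lemma lift_inner:
  assumes "\<xi> \<in> borel_measurable haar_circle" "\<eta> \<in> borel_measurable haar_circle"
  shows "L2_inner \<nu> (lift N 0 \<eta>) (lift N 0 \<xi>) = L2_inner (weighted_circle h) \<eta> \<xi>"
proof -
  note [measurable] = assms
  have "(\<integral>z. cnj (\<eta> z) * \<xi> z \<partial>weighted_circle h) = (\<integral>\<psi>. cnj (\<eta> (\<psi> 1)) * \<xi> (\<psi> 1) \<partial>\<nu>)"
    unfolding distr_eval_one[symmetric] by (rule integral_distr[OF eval_one_measurable]) measurable
  then show ?thesis by (simp add: L2_inner_def lift_def)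
qed

lemma pi_U_power_dilation:
  assumes T: "pi_U N m0 \<nu> T"
  shows "L2_power_dilation (weighted_circle h) \<nu> (lift N 0) (S0 N m0) T"
proof (rule L2_extension_imp_power_dilation[OF lift_isometry _ _ pi_U_extension[OF T]])
  show "L2_linear (weighted_circle h) (weighted_circle h) (S0 N m0)"
    using S0_isometry by (simp add: L2_isometry_def)
  show "L2_linear \<nu> \<nu> T" using T by (simp add: pi_U_def L2_bounded_operator_def)
qed (use L2_measurable in \<open>force intro!: lift_inner\<close>)

end

theorem lemma7p2:
  fixes N :: nat
    and m0 :: "complex \<Rightarrow> complex"
    and h :: "complex \<Rightarrow> real"
    and \<nu> :: "(rat \<Rightarrow> complex) measure"
  assumes "N \<ge> 2"
    and "wavelet_filter N m0"
    and "nonsingular m0"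
    and "integrable haar_circle h"
    and "AE z in haar_circle. 0 \<le> h z"
    and "AE z in haar_circle. transfer_op N m0 (\<lambda>w. of_real (h w)) z = of_real (h z)"
    and "solenoid_measure N m0 h \<nu>"
  shows "L2_isometry (weighted_circle h) \<nu> (lift N 0) \<and>
    L2_isometry (weighted_circle h) (weighted_circle h) (S0 N m0) \<and>
    (\<exists>T. pi_U N m0 \<nu> T) \<and>
    (\<forall>T. pi_U N m0 \<nu> T \<longrightarrow>
       L2_unitary \<nu> T \<and>
       L2_extension (weighted_circle h) \<nu> (lift N 0) (S0 N m0) T \<and>
       L2_power_dilation (weighted_circle h) \<nu> (lift N 0) (S0 N m0) T)"
proof -
  interpret solenoid_measure_setup N m0 h \<nu>
    using assms by unfold_locales (auto simp: wavelet_filter_def)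
  show ?thesis
    using lift_isometry S0_isometry shift_op_pi_U pi_U_unitary[OF assms(3)] pi_U_extension
      pi_U_power_dilation by blast
qed

end
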